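(* Let $H_1(s)$ and $H_2(s)$ be the $m\times m$ transfer functions of two proper LTI systems. Suppose that $H_1(s)$ and $H_2(s)$ are stable and that all zeros of $H_1(s)$ and of $H_2(s)$ have non-zero real part. For $i\in\{1,2\}$ let $\nu_i(\omega)$ and $\rho_i(\omega)$ be the $\omega$-IFP index and the $\omega$-OFP index of $H_i(s)$, respectively. Suppose that $$\nu_1(\omega)+\rho_2(\omega)>0 \quad\text{for all } \omega\in\mathbb{R}_{\ge 0}\qquad\text{and}\qquad \nu_2(\omega)+\rho_1(\omega)>0\quad\text{for all } \omega\in\mathbb{R}_{\ge 0}.$$ Let $H_\infty = \lim_{\omega\to\infty} H_1(j\omega)H_2(j\omega)$. If $-1$ is not an eigenvalue of $H_\infty$, then the feedback interconnection of $H_1$ and $H_2$ is stable.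
   Context: Here $j$ is the imaginary unit and $A^*$ denotes the complex-conjugate transpose of a matrix $A$. Systems: LTI systems $\dot x = Ax+Bu$, $x(0)=0$, $y=Cx+Du$ with real matrices, state in $\mathbb{R}^n$, input and output in $\mathbb{R}^m$ (not necessarily minimal); the transfer function is $H(s)=C(sI-A)^{-1}B+D$, an $m\times m$ matrix of rational functions of $s$ with real coefficients. A system is proper if $H(s)\to D$ as $|s|\to\infty$ for some $D\in\mathbb{R}^{m\times m}$. Poles and zeros: the pole polynomial $p(s)$ of a square transfer function $H(s)$ is the least common denominator of all minors of all orders of $H(s)$. The zero polynomial $z(s)$ is the numerator of $\det H(s)$ when $\det H(s)$ is written with denominator $p(s)$, i.e. $z(s)/p(s)=\det H(s)$. Poles and zeros of $H(s)$ are the roots of $p$ and $z$, respectively. $H(s)$ is stable if all its poles have negative real part. Frequency-dependent passivity indices: for a transfer function $H(s)$ all of whose poles and zeros have non-zero real part, and $\omega\in\mathbb{R}_{\ge0}$, the $\omega$-IFP index is $\nu(\omega)=\tfrac12\lambda_{\min}\big(H(j\omega)+H(j\omega)^*\big)$ and the $\omega$-OFP index is $\rho(\omega)=\tfrac12\lambda_{\min}\big(H(j\omega)^{-1}+(H(j\omega)^{-1})^*\big)$, where $\lambda_{\min}$ denotes the smallest eigenvalue of a Hermitian matrix. Feedback interconnection: the negative feedback loop with external input $r$ given by $u_1=r-y_2$, $y_1=H_1u_1$, $u_2=y_1$, $y_2=H_2u_2$. It is called stable if the closed-loop transfer function $H_3(s)$ defined by $y_2(s)=H_3(s)r(s)$,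 i.e. $H_3=(I+H_2H_1)^{-1}H_2H_1$, is stable. *)

theory Defs
  imports
    "Jordan_Normal_Form.Gauss_Jordan_Elimination"
    "Jordan_Normal_Form.DL_Submatrix"
    "Jordan_Normal_Form.Schur_Decomposition"
    "HOL-Computational_Algebra.Polynomial_Factorial"
    "HOL-Computational_Algebra.Field_as_Ring"
begin

type_synonym ratfun = "real poly fract"

definition const_ratfun :: "real \<Rightarrow> ratfun" where
  "const_ratfun c = to_fract [:c:]"

definition s_ratfun :: ratfun where
  "s_ratfun = to_fract [:0, 1:]"

definition complex_root :: "real poly \<Rightarrow> complex \<Rightarrow> bool" where
  "complex_root p s \<longleftrightarrow> poly (map_poly complex_of_real p) s = 0"

text \<open>Evaluation uses the reduced fraction, so removable singularities are removed; at a pole the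
  value is the irrelevant \<open>0\<close> of division by zero.\<close>

definition eval_ratfun :: "ratfun \<Rightarrow> complex \<Rightarrow> complex" where
  "eval_ratfun q s =
     poly (map_poly complex_of_real (fst (quot_of_fract q))) s /
     poly (map_poly complex_of_real (snd (quot_of_fract q))) s"

definition eval_tf :: "ratfun mat \<Rightarrow> complex \<Rightarrow> complex mat" where
  "eval_tf H s = map_mat (\<lambda>q. eval_ratfun q s) H"

text \<open>Only meaningful for invertible square matrices.\<close>

definition inv_mat :: "'a :: field mat \<Rightarrow> 'a mat" where
  "inv_mat M = the (mat_inverse M)"

definition mat_tendsto :: "('a \<Rightarrow> complex mat) \<Rightarrow> complex mat \<Rightarrow> 'a filter \<Rightarrow> bool" where
  "mat_tendsto F L net \<longleftrightarrow>
     (\<forall>\<^sub>F x in net. F x \<in> carrier_mat (dim_row L) (dim_col L)) \<and>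
     (\<forall>i<dim_row L. \<forall>j<dim_col L. ((\<lambda>x. F x $$ (i, j)) \<longlongrightarrow> L $$ (i, j)) net)"

definition lti_system ::
  "nat \<Rightarrow> nat \<Rightarrow> real mat \<Rightarrow> real mat \<Rightarrow> real mat \<Rightarrow> real mat \<Rightarrow> bool" where
  "lti_system n m A B C D \<longleftrightarrow>
     A \<in> carrier_mat n n \<and> B \<in> carrier_mat n m \<and> C \<in> carrier_mat m n \<and> D \<in> carrier_mat m m"

text \<open>The matrix \<open>s I - A\<close> is invertible over the field of rational functions, its determinant
  being the characteristic polynomial of \<open>A\<close>.\<close>

definition transfer_function :: "real mat \<Rightarrow> real mat \<Rightarrow> real mat \<Rightarrow> real mat \<Rightarrow> ratfun mat" where
  "transfer_function A B C D =
     map_mat const_ratfun C *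
     inv_mat (s_ratfun \<cdot>\<^sub>m 1\<^sub>m (dim_row A) - map_mat const_ratfun A) *
     map_mat const_ratfun B + map_mat const_ratfun D"

definition proper_tf :: "ratfun mat \<Rightarrow> bool" where
  "proper_tf H \<longleftrightarrow> (\<exists>D :: real mat. D \<in> carrier_mat (dim_row H) (dim_col H) \<and>
     mat_tendsto (eval_tf H) (map_mat complex_of_real D) at_infinity)"

definition minors :: "'a :: comm_ring_1 mat \<Rightarrow> 'a set" where
  "minors H = {det (submatrix H I J) | I J.
     I \<subseteq> {..<dim_row H} \<and> J \<subseteq> {..<dim_col H} \<and> card I = card J \<and> I \<noteq> {}}"

definition pole_polynomial :: "ratfun mat \<Rightarrow> real poly" where
  "pole_polynomial H = Lcm ((\<lambda>q. snd (quot_of_fract q)) ` minors H)"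

definition zero_polynomial :: "ratfun mat \<Rightarrow> real poly" where
  "zero_polynomial H = (THE z. to_fract z / to_fract (pole_polynomial H) = det H)"

definition pole_of :: "ratfun mat \<Rightarrow> complex \<Rightarrow> bool" where
  "pole_of H s \<longleftrightarrow> complex_root (pole_polynomial H) s"

text \<open>If \<open>det H\<close> is identically zero, then so is the zero polynomial, and every complex number
  is a zero.\<close>

definition zero_of :: "ratfun mat \<Rightarrow> complex \<Rightarrow> bool" where
  "zero_of H s \<longleftrightarrow> complex_root (zero_polynomial H) s"

definition stable_tf :: "ratfun mat \<Rightarrow> bool" where
  "stable_tf H \<longleftrightarrow> (\<forall>s. pole_of H s \<longrightarrow> Re s < 0)"

text \<open>Only meaningful for Hermitian matrices of positive dimension, whose eigenvalues are real.\<close>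

definition lambda_min :: "complex mat \<Rightarrow> real" where
  "lambda_min M = Min {x :: real. eigenvalue M (complex_of_real x)}"

definition ifp_index :: "ratfun mat \<Rightarrow> real \<Rightarrow> real" where
  "ifp_index H \<omega> =
     (let M = eval_tf H (\<i> * complex_of_real \<omega>) in 1 / 2 * lambda_min (M + mat_adjoint M))"

definition ofp_index :: "ratfun mat \<Rightarrow> real \<Rightarrow> real" where
  "ofp_index H \<omega> =
     (let N = inv_mat (eval_tf H (\<i> * complex_of_real \<omega>)) in 1 / 2 * lambda_min (N + mat_adjoint N))"

definition closed_loop :: "ratfun mat \<Rightarrow> ratfun mat \<Rightarrow> ratfun mat" where
  "closed_loop H1 H2 = inv_mat (1\<^sub>m (dim_row H1) + H2 * H1) * (H2 * H1)"

text \<open>Invertibility of \<open>I + H2 H1\<close> over the rational functions is what makes the closed-loop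
  transfer function well defined.\<close>

definition feedback_stable :: "ratfun mat \<Rightarrow> ratfun mat \<Rightarrow> bool" where
  "feedback_stable H1 H2 \<longleftrightarrow>
     invertible_mat (1\<^sub>m (dim_row H1) + H2 * H1) \<and> stable_tf (closed_loop H1 H2)"

end

theory Submission
  imports "HOL-Complex_Analysis.Great_Picard" Defs
begin

text \<open>
  At a frequency $\omega$ the indices say $\mathrm{Re}\langle Gx, x\rangle \ge \nu |x|^2$ and
  $\mathrm{Re}\langle Gx, x\rangle \ge \rho |Gx|^2$ for $G = H(j\omega)$. If $\nu_1 + \rho_2 > 0$ and
  $\rho_2 \ge 0$, these two bounds are incompatible with a kernel vector of $I + \tau G_1 G_2$ for any
  $\tau \in [0,1]$. The case $\rho_1 \ge 0$ is symmetric, and if both $\rho_i$ are negative, then both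
  $\nu_i$ are positive. Scaling $\tau$ down to $0$ then moves the loop to the trivial one without zeros
  crossing the imaginary axis, and by Hurwitz's theorem $\det(I + H_2 H_1)$ has no zero in the closed
  right half plane.

  The difficulty is at infinity, where only $\tau = 1$ is excluded: $\det(I + \tau D_2 D_1)$ may vanish
  for some $\tau < 1$, and zeros could then pass through infinity. In this critical case the limits of
  the indices force $D_1$ and $D_2$ to have positive semidefinite Hermitian parts and
  $\limsup \rho_i \le 0$. Replacing $H_i$ by $H_i + tI$ with a small $t > 0$ makes the loop strictly
  passive at infinity. It introduces no imaginary zeros: at high frequencies because $\rho_i$ is small,
  and at low frequencies by compactness. A single homotopy, $t = \epsilon k$ and $\tau = 1 - k$ with
  $k$ from $0$ to $1$, handles both cases ($\epsilon = 0$ in the noncritical one).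
\<close>

section \<open>Evaluation of rational functions\<close>

unbundle no vec_syntax
unbundle no inner_syntax

definition cpoly :: "real poly \<Rightarrow> complex \<Rightarrow> complex" where
  "cpoly p s = poly (map_poly complex_of_real p) s"

lemma cpoly_comm_ring_hom: "comm_ring_hom (\<lambda>p. cpoly p s)"
proof -
  interpret map_poly_comm_ring_hom complex_of_real ..
  show ?thesis by unfold_locales (simp_all add: cpoly_def hom_distribs)
qed

interpretation cpoly_hom: comm_ring_hom "\<lambda>p. cpoly p s" for s
  by (rule cpoly_comm_ring_hom)

lemma cpoly_cnj: "cpoly p (cnj s) = cnj (cpoly p s)"
  unfolding cpoly_def by (subst poly_cnj_real) (auto simp: coeff_map_poly)

lemma cpoly_holomorphic: "cpoly p holomorphic_on S"
  unfolding cpoly_def[abs_def] by (intro holomorphic_intros)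

definition regular_at :: "ratfun \<Rightarrow> complex \<Rightarrow> bool" where
  "regular_at q s \<longleftrightarrow> \<not> complex_root (snd (quot_of_fract q)) s"

lemma regular_at_iff: "regular_at q s \<longleftrightarrow> cpoly (snd (quot_of_fract q)) s \<noteq> 0"
  by (simp add: regular_at_def complex_root_def cpoly_def)

lemma eval_ratfun_eq: "eval_ratfun q s = cpoly (fst (quot_of_fract q)) s / cpoly (snd (quot_of_fract q)) s"
  by (simp add: eval_ratfun_def cpoly_def)

text \<open>By coprimality the reduced denominator divides every other denominator of the same
  fraction. Evaluation may therefore use any representative whose denominator does not vanish at
  \<open>s\<close>.\<close>

lemma regular_at_Fract:
  assumes "cpoly b s \<noteq> 0"
  shows "regular_at (Fract a b) s" "eval_ratfun (Fract a b) s = cpoly a s / cpoly b s"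
proof -
  define n d where "n = fst (quot_of_fract (Fract a b))" and "d = snd (quot_of_fract (Fract a b))"
  have b: "b \<noteq> 0" using assms by (auto simp: cpoly_def)
  have d: "d \<noteq> 0" by (simp add: d_def)
  have "Fract n d = Fract a b" by (simp add: n_def d_def)
  then have eq: "n * b = a * d" using b d by (simp add: eq_fract)
  have "coprime d n" unfolding n_def d_def using coprime_quot_of_fract coprime_commute by blast
  moreover have "d dvd n * b" by (simp add: eq)
  ultimately have "d dvd b" using coprime_dvd_mult_right_iff by blast
  then obtain c where "b = d * c" ..
  then have ds: "cpoly d s \<noteq> 0" using assms by (auto simp: cpoly_hom.hom_mult)
  then show "regular_at (Fract a b) s" by (simp add: regular_at_iff d_def)
  have "cpoly n s * cpoly b s = cpoly a s * cpoly d s"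
    using eq by (metis cpoly_hom.hom_mult)
  then show "eval_ratfun (Fract a b) s = cpoly a s / cpoly b s"
    using assms ds unfolding eval_ratfun_eq n_def[symmetric] d_def[symmetric]
    by (simp add: field_simps)
qed

lemma regular_at_0: "regular_at 0 s" and eval_ratfun_0: "eval_ratfun 0 s = 0"
  and regular_at_1: "regular_at 1 s" and eval_ratfun_1: "eval_ratfun 1 s = 1"
  by (simp_all add: regular_at_iff eval_ratfun_eq)

lemma regular_at_to_fract: "regular_at (to_fract p) s" "eval_ratfun (to_fract p) s = cpoly p s"
  using regular_at_Fract[of 1 s p] by (simp_all add: to_fract_def)

text \<open>At a pole \<open>eval_ratfun\<close> returns \<open>0\<close> and evaluation is no
  homomorphism, hence the regularity assumptions. For regular arguments the unreduced sum and
  product have the denominator \<open>b * d\<close>, nonzero at \<open>s\<close>, and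
  \<open>regular_at_Fract\<close> applies.\<close>

lemma
  assumes "regular_at q s" "regular_at r s"
  shows regular_at_add: "regular_at (q + r) s"
    and eval_ratfun_add: "eval_ratfun (q + r) s = eval_ratfun q s + eval_ratfun r s"
    and regular_at_mult: "regular_at (q * r) s"
    and eval_ratfun_mult: "eval_ratfun (q * r) s = eval_ratfun q s * eval_ratfun r s"
proof -
  obtain a b where q: "q = Fract a b" "b \<noteq> 0" "cpoly b s \<noteq> 0"
    by (metis Fract_quot_of_fract assms(1) regular_at_iff snd_quot_of_fract_nonzero)
  obtain c d where r: "r = Fract c d" "d \<noteq> 0" "cpoly d s \<noteq> 0"
    by (metis Fract_quot_of_fract assms(2) regular_at_iff snd_quot_of_fract_nonzero)
  have bd: "cpoly (b * d) s \<noteq> 0" using q r by (simp add: cpoly_hom.hom_mult)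
  show "regular_at (q + r) s" "regular_at (q * r) s"
    "eval_ratfun (q + r) s = eval_ratfun q s + eval_ratfun r s"
    "eval_ratfun (q * r) s = eval_ratfun q s * eval_ratfun r s"
    using q r regular_at_Fract[OF bd] regular_at_Fract[OF q(3)] regular_at_Fract[OF r(3)]
    by (simp_all add: cpoly_hom.hom_mult cpoly_hom.hom_add add_frac_eq)
qed

lemma
  assumes "\<And>i. i \<in> I \<Longrightarrow> regular_at (f i) s"
  shows regular_at_sum: "regular_at (sum f I) s"
    and eval_ratfun_sum: "eval_ratfun (sum f I) s = (\<Sum>i\<in>I. eval_ratfun (f i) s)"
  using assms by (induction I rule: infinite_finite_induct)
    (simp_all add: regular_at_add eval_ratfun_add regular_at_0 eval_ratfun_0)

lemma
  assumes "\<And>i. i \<in> I \<Longrightarrow> regular_at (f i) s"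
  shows regular_at_prod: "regular_at (prod f I) s"
    and eval_ratfun_prod: "eval_ratfun (prod f I) s = (\<Prod>i\<in>I. eval_ratfun (f i) s)"
  using assms by (induction I rule: infinite_finite_induct)
    (simp_all add: regular_at_mult eval_ratfun_mult regular_at_1 eval_ratfun_1)

lemma regular_at_inverse:
  assumes "eval_ratfun q s \<noteq> 0" "regular_at q s"
  shows "regular_at (inverse q) s"
proof -
  obtain a b where q: "q = Fract a b" "b \<noteq> 0" "cpoly b s \<noteq> 0"
    by (metis Fract_quot_of_fract assms(2) regular_at_iff snd_quot_of_fract_nonzero)
  then have "cpoly a s \<noteq> 0" using assms regular_at_Fract(2)[OF q(3), of a] by auto
  then show ?thesis using regular_at_Fract(1)[of a s b] q by simp
qed

lemma eval_ratfun_cnj: "eval_ratfun q (cnj s) = cnj (eval_ratfun q s)"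
  by (simp add: eval_ratfun_eq cpoly_cnj)

lemma eval_ratfun_holomorphic:
  assumes "\<And>s. s \<in> S \<Longrightarrow> regular_at q s"
  shows "eval_ratfun q holomorphic_on S"
  unfolding eval_ratfun_eq[abs_def] using assms
  by (intro holomorphic_intros cpoly_holomorphic) (simp add: regular_at_iff)

section \<open>Evaluation of matrices of rational functions\<close>

definition regular_mat_at :: "ratfun mat \<Rightarrow> complex \<Rightarrow> bool" where
  "regular_mat_at M s \<longleftrightarrow> (\<forall>i<dim_row M. \<forall>j<dim_col M. regular_at (M $$ (i, j)) s)"

lemma regular_mat_atD:
  "regular_mat_at M s \<Longrightarrow> i < dim_row M \<Longrightarrow> j < dim_col M \<Longrightarrow> regular_at (M $$ (i, j)) s"
  by (simp add: regular_mat_at_def)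

lemma regular_at_minus_1: "regular_at (-1) s"
  and eval_ratfun_minus_1: "eval_ratfun (-1) s = -1"
proof -
  have *: "to_fract (-1 :: real poly) = -1" by simp
  have "cpoly (-1) s = -1" by (metis cpoly_hom.hom_one cpoly_hom.hom_uminus)
  then show "regular_at (-1) s" "eval_ratfun (-1) s = -1"
    using regular_at_to_fract[of "-1" s] unfolding * by simp_all
qed

lemma regular_at_signof: "regular_at (signof p) s"
  and eval_ratfun_signof: "eval_ratfun (signof p) s = signof p"
  by (simp_all add: sign_def regular_at_1 eval_ratfun_1 regular_at_minus_1 eval_ratfun_minus_1)

lemma permutes_nat_less:
  fixes p :: "nat \<Rightarrow> nat"
  shows "p permutes {0..<n} \<Longrightarrow> i < n \<Longrightarrow> p i < n"
  using permutes_in_image[of p "{0..<n}" i] by simp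

text \<open>The Leibniz formula writes the determinant as a signed sum of products of entries, and
  evaluation respects sums and products at regular points.\<close>

lemma
  assumes M: "M \<in> carrier_mat n n" and reg: "regular_mat_at M s"
  shows regular_at_det: "regular_at (det M) s"
    and eval_ratfun_det: "eval_ratfun (det M) s = det (eval_tf M s)"
proof -
  have p: "regular_at (\<Prod>i = 0..<n. M $$ (i, p i)) s"
    "eval_ratfun (\<Prod>i = 0..<n. M $$ (i, p i)) s = (\<Prod>i = 0..<n. eval_ratfun (M $$ (i, p i)) s)"
    if "p permutes {0..<n}" for p
  proof -
    have *: "regular_at (M $$ (i, p i)) s" if "i \<in> {0..<n}" for i
    proof -
      have "p i < n" using \<open>p permutes {0..<n}\<close> that by (meson atLeastLessThan_iff permutes_in_image)
      then show ?thesis using M reg that by (auto intro: regular_mat_atD)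
    qed
    show "regular_at (\<Prod>i = 0..<n. M $$ (i, p i)) s"
    "eval_ratfun (\<Prod>i = 0..<n. M $$ (i, p i)) s = (\<Prod>i = 0..<n. eval_ratfun (M $$ (i, p i)) s)"
      by (rule regular_at_prod eval_ratfun_prod; use * in blast)+
  qed
  have d: "det M = (\<Sum>p\<in>{p. p permutes {0..<n}}. signof p * (\<Prod>i = 0..<n. M $$ (i, p i)))"
    by (rule det_def'[OF M])
  show "regular_at (det M) s" unfolding d
    by (intro regular_at_sum regular_at_mult regular_at_signof p) simp
  have "eval_ratfun (det M) s =
      (\<Sum>p\<in>{p. p permutes {0..<n}}. signof p * (\<Prod>i = 0..<n. eval_ratfun (M $$ (i, p i)) s))"
    unfolding d
    by (subst eval_ratfun_sum)
      (auto simp: eval_ratfun_mult regular_at_mult regular_at_signof p eval_ratfun_signof)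
  also have "\<dots> = (\<Sum>p\<in>{p. p permutes {0..<n}}. signof p * (\<Prod>i = 0..<n. eval_tf M s $$ (i, p i)))"
    unfolding eval_tf_def using M
    by (intro sum.cong refl arg_cong2[where f = "(*)"] prod.cong) (simp_all add: permutes_nat_less)
  also have "\<dots> = det (eval_tf M s)"
    by (rule det_def'[symmetric]) (use M in \<open>auto simp: eval_tf_def\<close>)
  finally show "eval_ratfun (det M) s = det (eval_tf M s)" .
qed

lemma eval_tf_carrier: "M \<in> carrier_mat nr nc \<Longrightarrow> eval_tf M s \<in> carrier_mat nr nc"
  by (simp add: eval_tf_def)

lemma
  assumes "A \<in> carrier_mat nr n" "B \<in> carrier_mat n nc" "regular_mat_at A s" "regular_mat_at B s"
  shows regular_mat_at_mult: "regular_mat_at (A * B) s"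
    and eval_tf_mult: "eval_tf (A * B) s = eval_tf A s * eval_tf B s"
proof -
  have e: "(A * B) $$ (i, j) = (\<Sum>k = 0..<n. A $$ (i, k) * B $$ (k, j))" if "i < nr" "j < nc" for i j
    using assms(1,2) that by (simp add: scalar_prod_def)
  have r: "regular_at (A $$ (i, k)) s" "regular_at (B $$ (k, j)) s" if "i < nr" "j < nc" "k < n" for i j k
    using assms that by (auto intro: regular_mat_atD)
  show "regular_mat_at (A * B) s"
    using assms(1,2) e r by (auto simp: regular_mat_at_def simp del: index_mult_mat(1)
        intro!: regular_at_sum regular_at_mult)
  show "eval_tf (A * B) s = eval_tf A s * eval_tf B s"
  proof (rule eq_matI)
    fix i j assume "i < dim_row (eval_tf A s * eval_tf B s)" "j < dim_col (eval_tf A s * eval_tf B s)"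
    then have ij: "i < nr" "j < nc" using assms(1,2) by (auto simp: eval_tf_def)
    have "eval_tf (A * B) s $$ (i, j) = eval_ratfun ((A * B) $$ (i, j)) s"
      using assms(1,2) ij by (simp add: eval_tf_def)
    also have "\<dots> = (\<Sum>k = 0..<n. eval_ratfun (A $$ (i, k)) s * eval_ratfun (B $$ (k, j)) s)"
      unfolding e[OF ij]
      by (subst eval_ratfun_sum) (use r[OF ij] in \<open>auto simp: regular_at_mult eval_ratfun_mult\<close>)
    also have "\<dots> = (eval_tf A s * eval_tf B s) $$ (i, j)"
      using assms(1,2) ij by (simp add: scalar_prod_def eval_tf_def)
    finally show "eval_tf (A * B) s $$ (i, j) = (eval_tf A s * eval_tf B s) $$ (i, j)" .
  qed (use assms in \<open>auto simp: eval_tf_def\<close>)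
qed

lemma
  assumes "A \<in> carrier_mat nr nc" "B \<in> carrier_mat nr nc" "regular_mat_at A s" "regular_mat_at B s"
  shows regular_mat_at_plus: "regular_mat_at (A + B) s"
    and eval_tf_plus: "eval_tf (A + B) s = eval_tf A s + eval_tf B s"
proof -
  show "regular_mat_at (A + B) s"
    using assms by (auto simp: regular_mat_at_def intro!: regular_at_add)
  show "eval_tf (A + B) s = eval_tf A s + eval_tf B s"
    by (rule eq_matI) (use assms in \<open>auto simp: eval_tf_def regular_mat_at_def intro!: eval_ratfun_add\<close>)
qed

lemma regular_mat_at_one: "regular_mat_at (1\<^sub>m n) s"
  and eval_tf_one: "eval_tf (1\<^sub>m n) s = 1\<^sub>m n"
  by (auto simp: regular_mat_at_def eval_tf_def regular_at_0 regular_at_1 eval_ratfun_0 eval_ratfun_1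
      intro!: eq_matI)

section \<open>Poles, zeros and the closed loop\<close>

lemma finite_minors: "finite (minors M)"
proof -
  have "minors M \<subseteq> (\<lambda>(I, J). det (submatrix M I J)) ` (Pow {..<dim_row M} \<times> Pow {..<dim_col M})"
    unfolding minors_def by auto
  then show ?thesis by (rule finite_subset) simp
qed

lemma snd_quot_of_fract_dvd_pole_polynomial:
  "q \<in> minors M \<Longrightarrow> snd (quot_of_fract q) dvd pole_polynomial M"
  unfolding pole_polynomial_def by (intro dvd_Lcm) simp

lemma pole_polynomial_dvd_prod: "pole_polynomial M dvd (\<Prod>q\<in>minors M. snd (quot_of_fract q))"
  unfolding pole_polynomial_def by (rule Lcm_least) (auto simp: finite_minors intro: dvd_prodI)

lemma pole_polynomial_nonzero: "pole_polynomial M \<noteq> 0"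
  using pole_polynomial_dvd_prod[of M] by (auto simp: finite_minors)

lemma pole_of_iff: "pole_of M s \<longleftrightarrow> cpoly (pole_polynomial M) s = 0"
  by (simp add: pole_of_def complex_root_def cpoly_def)

lemma cpoly_dvd_nonzero: "p dvd q \<Longrightarrow> cpoly q s \<noteq> 0 \<Longrightarrow> cpoly p s \<noteq> 0"
  by (auto simp: cpoly_hom.hom_mult elim!: dvdE)

text \<open>The pole polynomial is a multiple of each reduced denominator and divides their finite
  product, so its complex roots are exactly the roots of the individual denominators.\<close>

lemma not_pole_of_iff: "\<not> pole_of M s \<longleftrightarrow> (\<forall>q\<in>minors M. regular_at q s)"
proof
  assume "\<not> pole_of M s"
  then show "\<forall>q\<in>minors M. regular_at q s"
    unfolding pole_of_iff regular_at_iff using cpoly_dvd_nonzero snd_quot_of_fract_dvd_pole_polynomial by blast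
next
  assume *: "\<forall>q\<in>minors M. regular_at q s"
  have "cpoly (\<Prod>q\<in>A. snd (quot_of_fract q)) s \<noteq> 0" if "A \<subseteq> minors M" for A
    using that by (induction A rule: infinite_finite_induct)
      (use * in \<open>auto simp: cpoly_hom.hom_mult regular_at_iff\<close>)
  then show "\<not> pole_of M s"
    unfolding pole_of_iff using cpoly_dvd_nonzero[OF pole_polynomial_dvd_prod] by blast
qed

lemma submatrix_regular:
  assumes "regular_mat_at M s"
  shows "regular_mat_at (submatrix M I J) s"
  unfolding regular_mat_at_def dim_submatrix
proof (intro allI impI)
  fix i j assume ij: "i < card {i. i < dim_row M \<and> i \<in> I}" "j < card {j. j < dim_col M \<and> j \<in> J}"
  then have "pick I i < dim_row M" "pick J j < dim_col M" by (auto intro: pick_le)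
  then show "regular_at (submatrix M I J $$ (i, j)) s"
    unfolding submatrix_index[OF ij] using assms by (auto intro: regular_mat_atD)
qed

text \<open>Minors are polynomials in the entries, so a pole of a minor is already a pole of some
  entry.\<close>

lemma regular_mat_at_not_pole:
  assumes "regular_mat_at M s"
  shows "\<not> pole_of M s"
  unfolding not_pole_of_iff
proof
  fix q assume "q \<in> minors M"
  then obtain I J where q: "q = det (submatrix M I J)" and IJ: "I \<subseteq> {..<dim_row M}" "J \<subseteq> {..<dim_col M}"
    "card I = card J" unfolding minors_def by auto
  have "{i. i < dim_row M \<and> i \<in> I} = I" "{j. j < dim_col M \<and> j \<in> J} = J" using IJ by auto
  then have "submatrix M I J \<in> carrier_mat (card I) (card I)"
    by (intro carrier_matI) (auto simp: dim_submatrix IJ)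
  then show "regular_at q s" unfolding q by (rule regular_at_det) (rule submatrix_regular[OF assms])
qed

lemma entry_in_minors:
  assumes "i < dim_row M" "j < dim_col M"
  shows "M $$ (i, j) \<in> minors M"
proof -
  let ?S = "submatrix M {i} {j}"
  have s: "{a. a < dim_row M \<and> a \<in> {i}} = {i}" "{a. a < dim_col M \<and> a \<in> {j}} = {j}"
    "{a \<in> {i}. a < i} = {}" "{a \<in> {j}. a < j} = {}" using assms by auto
  have d: "dim_row ?S = 1" "dim_col ?S = 1" unfolding dim_submatrix s by simp_all
  have "?S $$ (0, 0) = M $$ (i, j)"
    using submatrix_index_card[of i M j "{i}" "{j}"] assms unfolding s by simp
  then have "det ?S = M $$ (i, j)" using d det_single[of ?S] by auto
  then show ?thesis using assms unfolding minors_def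
    by (intro CollectI exI[of _ "{i}"] exI[of _ "{j}"]) simp
qed

lemma det_in_minors:
  assumes "M \<in> carrier_mat m m" "0 < m"
  shows "det M \<in> minors M"
proof -
  have "submatrix M {..<m} {..<m} = M"
  proof (rule eq_matI)
    fix i j assume ij: "i < dim_row M" "j < dim_col M"
    \<comment> \<open>\<open>submatrix_index_card\<close> numbers a selected index by the count of
      smaller selected ones; when all are selected, this count is the index itself.\<close>
    then have "{a \<in> {..<m}. a < i} = {..<i}" "{a \<in> {..<m}. a < j} = {..<j}" using assms by auto
    then show "submatrix M {..<m} {..<m} $$ (i, j) = M $$ (i, j)"
      using submatrix_index_card[of i M j "{..<m}" "{..<m}"] assms ij by simp
  next
    have "{i. i < m \<and> i \<in> {..<m}} = {..<m}" by auto
    then show "dim_row (submatrix M {..<m} {..<m}) = dim_row M" "dim_col (submatrix M {..<m} {..<m}) = dim_col M"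
      using assms by (simp_all add: dim_submatrix)
  qed
  then show ?thesis using assms by (auto simp: minors_def intro!: exI[of _ "{..<m}"])
qed

text \<open>The entries are the minors of order one, so none of them can have a pole where
  \<open>M\<close> has none.\<close>

lemma stable_tf_regular:
  assumes "stable_tf M" "0 \<le> Re s"
  shows "regular_mat_at M s"
  using assms not_pole_of_iff[of M s] entry_in_minors
  unfolding stable_tf_def regular_mat_at_def by force

text \<open>The determinant is itself a minor, so its reduced denominator divides the pole
  polynomial and the required numerator is a polynomial. It is unique because
  \<open>to_fract\<close> is injective. This justifies the \<open>THE\<close> in
  \<open>zero_polynomial\<close>.\<close>

lemma to_fract_zero_polynomial:
  assumes "M \<in> carrier_mat m m" "0 < m"
  shows "to_fract (zero_polynomial M) = to_fract (pole_polynomial M) * det M"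
proof -
  let ?p = "pole_polynomial M"
  define n d where "n = fst (quot_of_fract (det M))" and "d = snd (quot_of_fract (det M))"
  have "d dvd ?p" unfolding d_def
    by (rule snd_quot_of_fract_dvd_pole_polynomial[OF det_in_minors[OF assms]])
  then obtain e where p: "?p = d * e" ..
  have d: "d \<noteq> 0" by (simp add: d_def)
  have e: "e \<noteq> 0" using p pole_polynomial_nonzero[of M] by auto
  have "det M = Fract n d" by (simp add: n_def d_def)
  then have ne: "to_fract (n * e) / to_fract ?p = det M"
    using d e by (simp add: p Fract_conv_to_fract)
  have "to_fract (zero_polynomial M) / to_fract ?p = det M"
    unfolding zero_polynomial_def
  proof (rule theI[where P = "\<lambda>z. to_fract z / to_fract ?p = det M"])
    fix z assume "to_fract z / to_fract ?p = det M"
    also have "\<dots> = to_fract (n * e) / to_fract ?p" using ne ..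
    finally have "to_fract z = to_fract (n * e)" using pole_polynomial_nonzero[of M] by simp
    then show "z = n * e" by (simp only: to_fract_eq_iff)
  qed (rule ne)
  then show ?thesis using pole_polynomial_nonzero[of M] by (simp add: field_simps)
qed

lemma det_eval_tf_nonzero:
  assumes M: "M \<in> carrier_mat m m" "0 < m" and reg: "regular_mat_at M s" and nz: "\<not> zero_of M s"
  shows "det (eval_tf M s) \<noteq> 0"
proof -
  have "cpoly (zero_polynomial M) s = eval_ratfun (to_fract (pole_polynomial M) * det M) s"
    unfolding to_fract_zero_polynomial[OF M, symmetric] by (simp add: regular_at_to_fract)
  also have "\<dots> = cpoly (pole_polynomial M) s * det (eval_tf M s)"
    by (simp add: eval_ratfun_mult regular_at_to_fract regular_at_det[OF M(1) reg] eval_ratfun_det[OF M(1) reg])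
  finally show ?thesis using nz by (auto simp: zero_of_def complex_root_def cpoly_def)
qed

section \<open>Matrix inverses and the poles of the closed loop\<close>

lemma inv_mat:
  fixes M :: "'a :: field mat"
  assumes M: "M \<in> carrier_mat n n" and det: "det M \<noteq> 0"
  shows "inv_mat M \<in> carrier_mat n n" "M * inv_mat M = 1\<^sub>m n" "inv_mat M * M = 1\<^sub>m n"
proof -
  have "M \<in> Units (ring_mat TYPE('a) n ())" using det_non_zero_imp_unit[OF M det] .
  then obtain B where B: "mat_inverse M = Some B" using mat_inverse(1)[OF M, of "()"] by fastforce
  then show "inv_mat M \<in> carrier_mat n n" "M * inv_mat M = 1\<^sub>m n" "inv_mat M * M = 1\<^sub>m n"
    using mat_inverse(2)[OF M B] by (simp_all add: inv_mat_def)
qed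

text \<open>Cramer's rule in this form exhibits the entries of the inverse as cofactors divided by
  the determinant, from which their regularity can be read off.\<close>

lemma inv_mat_adj:
  fixes M :: "'a :: field mat"
  assumes M: "M \<in> carrier_mat n n" and det: "det M \<noteq> 0"
  shows "inv_mat M = inverse (det M) \<cdot>\<^sub>m adj_mat M"
proof -
  note i = inv_mat[OF assms]
  note a = adj_mat[OF M]
  have "adj_mat M = adj_mat M * (M * inv_mat M)"
    unfolding i(2) using a(1) by (rule right_mult_one_mat[symmetric])
  also have "\<dots> = (adj_mat M * M) * inv_mat M" using assoc_mult_mat[OF a(1) M i(1)] by simp
  also have "\<dots> = det M \<cdot>\<^sub>m inv_mat M" unfolding a(3)
    using mult_smult_assoc_mat[OF one_carrier_mat i(1)] i(1) by simp
  finally have "adj_mat M = det M \<cdot>\<^sub>m inv_mat M" .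
  then show ?thesis using i(1) det by (intro eq_matI) auto
qed

lemma regular_mat_at_inv_mat:
  assumes M: "M \<in> carrier_mat n n" and reg: "regular_mat_at M s" and det: "det (eval_tf M s) \<noteq> 0"
  shows "det M \<noteq> 0" "regular_mat_at (inv_mat M) s"
proof -
  have ev: "eval_ratfun (det M) s \<noteq> 0" using det eval_ratfun_det[OF M reg] by simp
  then show nz: "det M \<noteq> 0" by (auto simp: eval_ratfun_0)
  have "regular_at (adj_mat M $$ (i, j)) s" if ij: "i < n" "j < n" for i j
  proof -
    have "regular_mat_at (mat_delete M j i) s"
      using M reg ij unfolding regular_mat_at_def
      by (auto simp: mat_delete_def)
    moreover have "mat_delete M j i \<in> carrier_mat (n - 1) (n - 1)" using M by (auto simp: mat_delete_def)
    ultimately have "regular_at (det (mat_delete M j i)) s" by (rule regular_at_det[rotated])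
    moreover have "regular_at ((-1)^k) s" for k
      by (cases "even k") (simp_all add: regular_at_1 regular_at_minus_1)
    ultimately show ?thesis using M ij by (simp add: adj_mat_def cofactor_def regular_at_mult)
  qed
  then show "regular_mat_at (inv_mat M) s"
    unfolding inv_mat_adj[OF M nz] using M adj_mat(1)[OF M] regular_at_inverse[OF ev regular_at_det[OF M reg]]
    by (auto simp: regular_mat_at_def intro!: regular_at_mult)
qed

text \<open>Stability reduces to one scalar condition: where the determinant does not vanish, the
  inverse of \<open>I + H2 H1\<close> is regular, so the closed loop is regular and has no
  pole.\<close>

lemma feedback_stableI:
  assumes H: "H1 \<in> carrier_mat m m" "H2 \<in> carrier_mat m m"
    and reg: "\<And>s. 0 \<le> Re s \<Longrightarrow> regular_mat_at H1 s" "\<And>s. 0 \<le> Re s \<Longrightarrow> regular_mat_at H2 s"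
    and det: "\<And>s. 0 \<le> Re s \<Longrightarrow> det (1\<^sub>m m + eval_tf H2 s * eval_tf H1 s) \<noteq> 0"
  shows "feedback_stable H1 H2"
proof -
  let ?M = "1\<^sub>m m + H2 * H1"
  have M: "?M \<in> carrier_mat m m" and P: "H2 * H1 \<in> carrier_mat m m" using H by auto
  have rP: "regular_mat_at (H2 * H1) s" if "0 \<le> Re s" for s
    using regular_mat_at_mult[OF H(2,1)] reg that by blast
  have rM: "regular_mat_at ?M s" if "0 \<le> Re s" for s
    using regular_mat_at_plus[OF one_carrier_mat P regular_mat_at_one rP] that by blast
  have "eval_tf ?M s = 1\<^sub>m m + eval_tf H2 s * eval_tf H1 s" if "0 \<le> Re s" for s
    using eval_tf_plus[OF one_carrier_mat P regular_mat_at_one rP] that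
      eval_tf_mult[OF H(2,1)] reg by (simp add: eval_tf_one)
  then have dM: "det (eval_tf ?M s) \<noteq> 0" if "0 \<le> Re s" for s using that det by simp
  note inv = regular_mat_at_inv_mat[OF M rM dM]
  \<comment> \<open>A single evaluation point suffices for invertibility over the rational
    functions.\<close>
  have nz: "det ?M \<noteq> 0" using inv(1)[of 0] by simp
  have "invertible_mat ?M"
    using M inv_mat[OF M nz] unfolding invertible_mat_def inverts_mat_def square_mat.simps
    by (metis carrier_matD)
  moreover have "\<not> pole_of (inv_mat ?M * (H2 * H1)) s" if "0 \<le> Re s" for s
    using regular_mat_at_mult[OF inv_mat(1)[OF M nz] P inv(2) rP] that
    by (intro regular_mat_at_not_pole) auto
  then have "stable_tf (closed_loop H1 H2)"
    using H unfolding stable_tf_def closed_loop_def by (auto simp: not_le[symmetric])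
  ultimately show ?thesis using H by (simp add: feedback_stable_def)
qed

section \<open>Hermitian forms and passivity indices\<close>

lemma cscalar_prod_sum:
  "x \<in> carrier_vec n \<Longrightarrow> y \<in> carrier_vec n \<Longrightarrow> x \<bullet>c y = (\<Sum>i<n. x $ i * cnj (y $ i))"
  by (auto simp: scalar_prod_def lessThan_atLeast0 intro!: sum.cong)

definition sqnorm :: "complex vec \<Rightarrow> real" where
  "sqnorm x = Re (x \<bullet>c x)"

lemma sqnorm_sum: "x \<in> carrier_vec n \<Longrightarrow> sqnorm x = (\<Sum>i<n. (cmod (x $ i))\<^sup>2)"
  by (simp add: sqnorm_def cscalar_prod_sum complex_mult_cnj cmod_power2)

lemma sqnorm_nonneg: "0 \<le> sqnorm x"
  using sqnorm_sum[of x "dim_vec x"] by (simp add: sum_nonneg)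

lemma sqnorm_eq_0:
  assumes "x \<in> carrier_vec n" "sqnorm x = 0"
  shows "x = 0\<^sub>v n"
proof (rule eq_vecI)
  fix i assume "i < dim_vec (0\<^sub>v n)"
  then show "x $ i = 0\<^sub>v n $ i"
    using assms sqnorm_sum[OF assms(1)] by (simp add: sum_nonneg_eq_0_iff)
qed (use assms in auto)

lemma ip_add_left: "x \<in> carrier_vec n \<Longrightarrow> y \<in> carrier_vec n \<Longrightarrow> z \<in> carrier_vec n \<Longrightarrow>
    (x + y) \<bullet>c z = x \<bullet>c z + (y \<bullet>c z :: complex)"
  by (simp add: cscalar_prod_sum[of _ n] sum.distrib algebra_simps)

lemma ip_add_right: "x \<in> carrier_vec n \<Longrightarrow> y \<in> carrier_vec n \<Longrightarrow> z \<in> carrier_vec n \<Longrightarrow>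
    z \<bullet>c (x + y) = z \<bullet>c x + (z \<bullet>c y :: complex)"
  by (simp add: cscalar_prod_sum[of _ n] sum.distrib algebra_simps)

lemma ip_smult_left: "x \<in> carrier_vec n \<Longrightarrow> z \<in> carrier_vec n \<Longrightarrow>
    (c \<cdot>\<^sub>v x) \<bullet>c z = c * (x \<bullet>c z :: complex)"
  by (simp add: cscalar_prod_sum[of _ n] sum_distrib_left algebra_simps)

lemma ip_smult_right: "x \<in> carrier_vec n \<Longrightarrow> z \<in> carrier_vec n \<Longrightarrow>
    z \<bullet>c (c \<cdot>\<^sub>v x) = cnj c * (z \<bullet>c x :: complex)"
  by (simp add: cscalar_prod_sum[of _ n] sum_distrib_left algebra_simps)

lemma ip_commute: "x \<in> carrier_vec n \<Longrightarrow> y \<in> carrier_vec n \<Longrightarrow> y \<bullet>c x = cnj (x \<bullet>c y)"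
  by (simp add: cscalar_prod_sum[of _ n] mult.commute)

lemma Re_ip_commute: "x \<in> carrier_vec n \<Longrightarrow> y \<in> carrier_vec n \<Longrightarrow> Re (y \<bullet>c x) = Re (x \<bullet>c y)"
  using ip_commute[of x n y] by simp

lemma mat_adjoint_index:
  assumes "M \<in> carrier_mat nr nc" "i < nc" "j < nr"
  shows "(mat_adjoint M :: complex mat) $$ (i, j) = cnj (M $$ (j, i))"
  using assms by (simp add: mat_adjoint_def mat_of_rows_index)

lemma mat_adjoint_carrier:
  "M \<in> carrier_mat nr nc \<Longrightarrow> mat_adjoint M \<in> carrier_mat nc nr"
  by (simp add: mat_adjoint_def mat_of_rows_def)

lemma mat_adjoint_ip:
  assumes M: "(M :: complex mat) \<in> carrier_mat n n" and x: "x \<in> carrier_vec n" and y: "y \<in> carrier_vec n"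
  shows "(mat_adjoint M *\<^sub>v x) \<bullet>c y = x \<bullet>c (M *\<^sub>v y)"
proof -
  have "(mat_adjoint M *\<^sub>v x) \<bullet>c y = (\<Sum>i<n. (\<Sum>j<n. cnj (M $$ (j, i)) * x $ j) * cnj (y $ i))"
    using mat_adjoint_carrier[OF M] x y M
    by (subst cscalar_prod_sum[of _ n])
      (auto simp: scalar_prod_def lessThan_atLeast0 mat_adjoint_index[OF M] intro!: sum.cong)
  also have "\<dots> = (\<Sum>i<n. \<Sum>j<n. cnj (M $$ (j, i)) * x $ j * cnj (y $ i))"
    by (simp add: sum_distrib_right)
  also have "\<dots> = (\<Sum>j<n. \<Sum>i<n. cnj (M $$ (j, i)) * x $ j * cnj (y $ i))"
    by (rule sum.swap)
  also have "\<dots> = (\<Sum>j<n. x $ j * cnj (\<Sum>i<n. M $$ (j, i) * y $ i))"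
    by (simp add: sum_distrib_left algebra_simps)
  also have "\<dots> = x \<bullet>c (M *\<^sub>v y)"
    using x y M
    by (subst cscalar_prod_sum[of _ n])
      (auto simp: scalar_prod_def lessThan_atLeast0 simp del: cnj_sum intro!: sum.cong)
  finally show ?thesis .
qed

text \<open>The unit sphere is realized in the product space of sequences, padded by zeros from
  index \<open>n\<close> on. There it is a closed subset of a product of closed discs, which is
  compact by Tychonoff's theorem.\<close>

lemma compact_unit_sphere_seq:
  fixes n :: nat
  shows "compact {v :: nat \<Rightarrow> complex. (\<forall>i\<ge>n. v i = 0) \<and> (\<Sum>i<n. (cmod (v i))\<^sup>2) = 1}" (is "compact ?S")
proof -
  have c: "continuous_on UNIV (\<lambda>v :: nat \<Rightarrow> complex. v i)" for i
    by (rule continuous_on_product_coordinates)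
  have "closed {v :: nat \<Rightarrow> complex. i \<ge> n \<longrightarrow> v i = 0}" for i
    by (cases "i \<ge> n") (auto intro!: closed_Collect_eq c continuous_intros)
  then have "closed {v :: nat \<Rightarrow> complex. \<forall>i. i \<ge> n \<longrightarrow> v i = 0}" by (rule closed_Collect_all)
  moreover have "closed {v :: nat \<Rightarrow> complex. (\<Sum>i<n. (cmod (v i))\<^sup>2) = 1}"
    by (intro closed_Collect_eq continuous_intros c)
  ultimately have "closed ?S" by (rule closed_Collect_conj)
  moreover have "compact (\<Pi>\<^sub>E i\<in>(UNIV :: nat set). cball (0 :: complex) 1)"
    unfolding compactin_euclidean_iff[symmetric] euclidean_product_topology[symmetric] compactin_PiE
    by (simp add: compactin_euclidean_iff)
  moreover have "?S \<subseteq> (\<Pi>\<^sub>E i\<in>(UNIV :: nat set). cball (0 :: complex) 1)"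
  proof
    fix v assume v: "v \<in> ?S"
    have "cmod (v i) \<le> 1" for i
    proof (cases "i < n")
      case True
      then have "(cmod (v i))\<^sup>2 \<le> (\<Sum>i<n. (cmod (v i))\<^sup>2)" by (intro member_le_sum) auto
      then have "(cmod (v i))\<^sup>2 \<le> 1" using v by simp
      then show ?thesis by (simp add: power_le_one_iff)
    qed (use v in auto)
    then show "v \<in> (\<Pi>\<^sub>E i\<in>(UNIV :: nat set). cball (0 :: complex) 1)" by (auto simp: PiE_def)
  qed
  ultimately show ?thesis
    using closed_Int_compact[of ?S "\<Pi>\<^sub>E i\<in>UNIV. cball 0 1"] by (simp only: inf.absorb1)
qed

text \<open>The form is continuous on the compact unit sphere and so attains its minimum there;
  scaling by \<open>sqrt (sqnorm y)\<close> extends the bound to all vectors.\<close>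

lemma quadratic_form_attains_min:
  assumes M: "M \<in> carrier_mat n n" and n: "0 < n"
  obtains x where "x \<in> carrier_vec n" "sqnorm x = 1"
    "\<And>y. y \<in> carrier_vec n \<Longrightarrow> Re ((M *\<^sub>v x) \<bullet>c x) * sqnorm y \<le> Re ((M *\<^sub>v y) \<bullet>c y)"
proof -
  define S where "S = {v :: nat \<Rightarrow> complex. (\<forall>i\<ge>n. v i = 0) \<and> (\<Sum>i<n. (cmod (v i))\<^sup>2) = 1}"
  define f where "f v = Re (\<Sum>i<n. (\<Sum>j<n. M $$ (i, j) * v j) * cnj (v i))" for v
  have f: "Re ((M *\<^sub>v vec n v) \<bullet>c vec n v) = f v" for v
    unfolding f_def using M
    by (subst cscalar_prod_sum[of _ n]) (auto simp: scalar_prod_def lessThan_atLeast0 intro!: sum.cong arg_cong[where f = Re])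
  have c: "continuous_on UNIV (\<lambda>v :: nat \<Rightarrow> complex. v i)" for i
    by (rule continuous_on_product_coordinates)
  have "continuous_on S f"
    unfolding f_def by (intro continuous_intros continuous_on_subset[OF c]) auto
  moreover have "(\<lambda>i. if i = 0 then 1 else 0) \<in> S"
  proof -
    have "(\<Sum>i<n. (cmod (if i = 0 then 1 else 0))\<^sup>2) = (\<Sum>i<n. if i = 0 then 1 else 0 :: real)"
      by (intro sum.cong) auto
    then show ?thesis using n by (simp add: S_def)
  qed
  ultimately obtain v where v: "v \<in> S" and min: "\<And>w. w \<in> S \<Longrightarrow> f v \<le> f w"
    using continuous_attains_inf[of S f] compact_unit_sphere_seq[of n] unfolding S_def[symmetric] by blast
  show thesis
  proof
    show "vec n v \<in> carrier_vec n" by simp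
    show "sqnorm (vec n v) = 1" using v by (simp add: sqnorm_sum[of _ n] S_def)
    fix y :: "complex vec" assume y: "y \<in> carrier_vec n"
    show "Re ((M *\<^sub>v vec n v) \<bullet>c vec n v) * sqnorm y \<le> Re ((M *\<^sub>v y) \<bullet>c y)"
    proof (cases "sqnorm y = 0")
      case True
      then have "y = 0\<^sub>v n" using y sqnorm_eq_0 by blast
      then show ?thesis using M True by simp
    next
      case False
      define r where "r = sqrt (sqnorm y)"
      have r: "r > 0" "r\<^sup>2 = sqnorm y" using False sqnorm_nonneg[of y] by (auto simp: r_def)
      define w where "w i = (if i < n then y $ i / r else 0)" for i
      have "(\<Sum>i<n. (cmod (w i))\<^sup>2) = sqnorm y / r\<^sup>2"
        by (simp add: w_def norm_divide power_divide sqnorm_sum[OF y] sum_divide_distrib)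
      then have "w \<in> S" using r False by (simp add: S_def w_def)
      then have le: "f v \<le> f w" by (rule min)
      have yw: "y = complex_of_real r \<cdot>\<^sub>v vec n w" using y r by (auto simp: w_def)
      have "Re ((M *\<^sub>v y) \<bullet>c y) = r\<^sup>2 * f w"
        unfolding yw using M f[of w]
        by (simp add: mult_mat_vec[OF M] ip_smult_left[of _ n] ip_smult_right[of _ n] power2_eq_square)
      then show ?thesis using le unfolding f r(2)[symmetric] by (simp add: mult.commute[of "r\<^sup>2"] mult_right_mono)
    qed
  qed
qed

text \<open>First-order condition: the expression is minimal at \<open>s = 0\<close>, so its
  derivative \<open>2 * a\<close> there vanishes.\<close>

lemma linear_term_zero:
  fixes a d :: real
  assumes "\<And>s. 0 \<le> 2 * s * a + s\<^sup>2 * d"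
  shows "a = 0"
proof -
  define c where "c = 1 + \<bar>d\<bar>"
  have c: "c > 0" "2 * c - d > 0" by (simp_all add: c_def)
  \<comment> \<open>At \<open>s = - (a / c)\<close> the expression times \<open>c\<^sup>2\<close> is
    \<open>a\<^sup>2 * (d - 2 * c)\<close>, negative unless \<open>a = 0\<close>, since
    \<open>2 * c > d\<close>.\<close>
  have "0 \<le> (2 * (- (a / c)) * a + (- (a / c))\<^sup>2 * d) * c\<^sup>2"
    by (intro mult_nonneg_nonneg assms) simp
  also have "\<dots> = a\<^sup>2 * (d - 2 * c)"
    using c by (simp add: field_simps power2_eq_square)
  finally have "a\<^sup>2 * (2 * c - d) \<le> 0" by (simp add: algebra_simps)
  then show ?thesis using c by (simp add: mult_le_0_iff)
qed

text \<open>Rayleigh's principle: a minimizer \<open>x\<close> of the form on the unit sphere is an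
  eigenvector whose eigenvalue is the minimum \<open>t\<close>. Hence \<open>lambda_min M\<close> is
  at most \<open>t\<close>, and \<open>t\<close> bounds the form from below.\<close>

lemma lambda_min_le:
  assumes M: "M \<in> carrier_mat n n" and n: "0 < n" and herm: "mat_adjoint M = M" and y: "y \<in> carrier_vec n"
  shows "lambda_min M * sqnorm y \<le> Re ((M *\<^sub>v y) \<bullet>c y)"
proof -
  obtain x where x: "x \<in> carrier_vec n" "sqnorm x = 1"
    and min: "\<And>y. y \<in> carrier_vec n \<Longrightarrow> Re ((M *\<^sub>v x) \<bullet>c x) * sqnorm y \<le> Re ((M *\<^sub>v y) \<bullet>c y)"
    using quadratic_form_attains_min[OF M n] by blast
  define t where "t = Re ((M *\<^sub>v x) \<bullet>c x)"
  \<comment> \<open>\<open>w\<close> is the residual of the eigenvalue equation. Varying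
    \<open>x\<close> in the direction \<open>w\<close> makes the first-order coefficient equal to
    \<open>2 * sqnorm w\<close>, which must vanish at a minimum.\<close>
  define w where "w = M *\<^sub>v x + complex_of_real (- t) \<cdot>\<^sub>v x"
  define d where "d = Re ((M *\<^sub>v w) \<bullet>c w) - t * sqnorm w"
  have Mx: "M *\<^sub>v x \<in> carrier_vec n" and w: "w \<in> carrier_vec n" and Mw: "M *\<^sub>v w \<in> carrier_vec n"
    using M x by (auto simp: w_def)
  have "0 \<le> 2 * s * sqnorm w + s\<^sup>2 * d" for s :: real
  proof -
    let ?y = "x + complex_of_real s \<cdot>\<^sub>v w"
    have y: "?y \<in> carrier_vec n" using x w by simp
    have Mwx: "Re ((M *\<^sub>v w) \<bullet>c x) = Re ((M *\<^sub>v x) \<bullet>c w)"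
      using mat_adjoint_ip[OF M w x(1)] herm Re_ip_commute[OF w Mx] by simp
    have "Re ((M *\<^sub>v ?y) \<bullet>c ?y) = t + 2 * s * Re ((M *\<^sub>v x) \<bullet>c w) + s\<^sup>2 * Re ((M *\<^sub>v w) \<bullet>c w)"
      using x w Mx Mw Mwx
      by (simp add: mult_add_distrib_mat_vec[OF M] mult_mat_vec[OF M] ip_add_left[of _ n] ip_add_right[of _ n]
          ip_smult_left[of _ n] ip_smult_right[of _ n] t_def power2_eq_square algebra_simps)
    moreover have "sqnorm ?y = 1 + 2 * s * Re (x \<bullet>c w) + s\<^sup>2 * sqnorm w"
      using x w Re_ip_commute[of x n w]
      by (simp add: sqnorm_def ip_add_left[of _ n] ip_add_right[of _ n]
          ip_smult_left[of _ n] ip_smult_right[of _ n] power2_eq_square algebra_simps)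
    moreover have "sqnorm w = Re ((M *\<^sub>v x) \<bullet>c w) - t * Re (x \<bullet>c w)"
      unfolding sqnorm_def by (subst w_def)
        (use x w Mx in \<open>simp add: ip_add_left[of _ n] ip_smult_left[of _ n]\<close>)
    then have "Re ((M *\<^sub>v x) \<bullet>c w) = sqnorm w + t * Re (x \<bullet>c w)" by simp
    ultimately have "Re ((M *\<^sub>v ?y) \<bullet>c ?y) - t * sqnorm ?y = 2 * s * sqnorm w + s\<^sup>2 * d"
      unfolding d_def by (simp only:) (simp add: algebra_simps)
    then show ?thesis
      using min[OF y] by (simp add: t_def[symmetric])
  qed
  then have "sqnorm w = 0" by (rule linear_term_zero)
  then have "w = 0\<^sub>v n" using w sqnorm_eq_0 by blast
  have ev: "M *\<^sub>v x = complex_of_real t \<cdot>\<^sub>v x"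
  proof (rule eq_vecI)
    fix i assume "i < dim_vec (complex_of_real t \<cdot>\<^sub>v x)"
    then have i: "i < n" using x by simp
    have "w $ i = 0" using \<open>w = 0\<^sub>v n\<close> i by simp
    then show "(M *\<^sub>v x) $ i = (complex_of_real t \<cdot>\<^sub>v x) $ i"
      unfolding w_def using i x Mx by (simp add: algebra_simps)
  qed (use x M in auto)
  have "x \<noteq> 0\<^sub>v n" using x by (auto simp: sqnorm_def)
  then have "eigenvalue M (complex_of_real t)"
    unfolding eigenvalue_def eigenvector_def using M x ev by auto
  \<comment> \<open>\<open>Min\<close> is informative only on finite sets; the eigenvalues are roots
    of the characteristic polynomial.\<close>
  moreover have "finite {x :: real. eigenvalue M (complex_of_real x)}"
  proof -
    have "finite {z. poly (char_poly M) z = 0}"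
      using degree_monic_char_poly[OF M] by (intro poly_roots_finite) auto
    then have "finite (complex_of_real -` {z. poly (char_poly M) z = 0})"
      by (rule finite_vimageI) (simp add: inj_of_real)
    then show ?thesis by (simp add: eigenvalue_root_char_poly[OF M] vimage_def)
  qed
  ultimately have "lambda_min M \<le> t" unfolding lambda_min_def by (intro Min_le) auto
  then show ?thesis using min[OF y] sqnorm_nonneg[of y] unfolding t_def[symmetric]
    by (meson mult_right_mono order_trans)
qed

text \<open>A matrix and its adjoint have the same real part of the quadratic form, so the form of
  \<open>M + mat_adjoint M\<close> is twice that of \<open>M\<close>.\<close>

lemma hermitian_part_bound:
  assumes M: "M \<in> carrier_mat n n" and n: "0 < n" and y: "y \<in> carrier_vec n"
  shows "1 / 2 * lambda_min (M + mat_adjoint M) * sqnorm y \<le> Re ((M *\<^sub>v y) \<bullet>c y)"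
proof -
  let ?N = "M + mat_adjoint M"
  note A = mat_adjoint_carrier[OF M]
  have N: "?N \<in> carrier_mat n n" using M A by simp
  have "mat_adjoint ?N = ?N"
    by (rule eq_matI) (use M A N mat_adjoint_carrier[OF N] in \<open>auto simp: mat_adjoint_index[OF N] mat_adjoint_index[OF M]\<close>)
  from lambda_min_le[OF N n this y]
  have "lambda_min ?N * sqnorm y \<le> Re ((M *\<^sub>v y) \<bullet>c y) + Re ((mat_adjoint M *\<^sub>v y) \<bullet>c y)"
    using M A y by (simp add: add_mult_distrib_mat_vec[OF M A y] ip_add_left[of _ n])
  also have "Re ((mat_adjoint M *\<^sub>v y) \<bullet>c y) = Re ((M *\<^sub>v y) \<bullet>c y)"
    unfolding mat_adjoint_ip[OF M y y] using M y by (intro Re_ip_commute[of _ n]) auto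
  finally show ?thesis by simp
qed

section \<open>Passivity indices as bounds on quadratic forms\<close>

definition ifp :: "complex mat \<Rightarrow> real \<Rightarrow> bool" where
  "ifp G \<nu> \<longleftrightarrow> (\<forall>x\<in>carrier_vec (dim_row G). \<nu> * sqnorm x \<le> Re ((G *\<^sub>v x) \<bullet>c x))"

text \<open>The inverse is avoided by substituting $Gx$ for the argument of the form of $G^{-1}$.\<close>

definition ofp :: "complex mat \<Rightarrow> real \<Rightarrow> bool" where
  "ofp G \<rho> \<longleftrightarrow> (\<forall>x\<in>carrier_vec (dim_row G). \<rho> * sqnorm (G *\<^sub>v x) \<le> Re ((G *\<^sub>v x) \<bullet>c x))"

lemma ifpD: "ifp G \<nu> \<Longrightarrow> G \<in> carrier_mat n n \<Longrightarrow> x \<in> carrier_vec n \<Longrightarrow>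
    \<nu> * sqnorm x \<le> Re ((G *\<^sub>v x) \<bullet>c x)"
  by (auto simp: ifp_def)

lemma ofpD: "ofp G \<rho> \<Longrightarrow> G \<in> carrier_mat n n \<Longrightarrow> x \<in> carrier_vec n \<Longrightarrow>
    \<rho> * sqnorm (G *\<^sub>v x) \<le> Re ((G *\<^sub>v x) \<bullet>c x)"
  by (auto simp: ofp_def)

lemma ifp_index_ifp:
  assumes "H \<in> carrier_mat m m" "0 < m"
  shows "ifp (eval_tf H (\<i> * complex_of_real \<omega>)) (ifp_index H \<omega>)"
  using assms hermitian_part_bound[OF eval_tf_carrier[OF assms(1)] assms(2)]
  by (auto simp: ifp_def ifp_index_def Let_def eval_tf_def)

lemma ofp_index_ofp:
  assumes H: "H \<in> carrier_mat m m" "0 < m" and det: "det (eval_tf H (\<i> * complex_of_real \<omega>)) \<noteq> 0"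
  shows "ofp (eval_tf H (\<i> * complex_of_real \<omega>)) (ofp_index H \<omega>)"
  unfolding ofp_def
proof
  let ?G = "eval_tf H (\<i> * complex_of_real \<omega>)"
  fix x :: "complex vec" assume "x \<in> carrier_vec (dim_row ?G)"
  then have x: "x \<in> carrier_vec m" using H by (simp add: eval_tf_def)
  have G: "?G \<in> carrier_mat m m" using H(1) by (rule eval_tf_carrier)
  note i = inv_mat[OF G det]
  let ?z = "?G *\<^sub>v x"
  have z: "?z \<in> carrier_vec m" using G x by simp
  have "inv_mat ?G *\<^sub>v ?z = x"
    using i x assoc_mult_mat_vec[OF i(1) G x] by simp
  then have "ofp_index H \<omega> * sqnorm ?z \<le> Re (x \<bullet>c ?z)"
    using hermitian_part_bound[OF i(1) H(2) z] by (simp add: ofp_index_def Let_def)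
  then show "ofp_index H \<omega> * sqnorm ?z \<le> Re (?z \<bullet>c x)"
    using Re_ip_commute[OF x z] by simp
qed

section \<open>The shifted and scaled loop at one frequency\<close>

definition shift_mat :: "nat \<Rightarrow> real \<Rightarrow> complex mat \<Rightarrow> complex mat" where
  "shift_mat m t G = G + complex_of_real t \<cdot>\<^sub>m 1\<^sub>m m"

text \<open>This is the two-parameter family of the homotopy: \<open>\<tau>\<close> scales the loop
  gain and \<open>t\<close> shifts both systems. The given loop has \<open>\<tau> = 1\<close> and
  \<open>t = 0\<close>; for \<open>\<tau> = 0\<close> the matrix is the identity.\<close>

definition loop_mat :: "nat \<Rightarrow> real \<Rightarrow> real \<Rightarrow> complex mat \<Rightarrow> complex mat \<Rightarrow> complex mat" where
  "loop_mat m \<tau> t G1 G2 = 1\<^sub>m m + complex_of_real \<tau> \<cdot>\<^sub>m (shift_mat m t G1 * shift_mat m t G2)"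

lemma shift_mat_carrier [simp]: "G \<in> carrier_mat m m \<Longrightarrow> shift_mat m t G \<in> carrier_mat m m"
  by (simp add: shift_mat_def)

lemma loop_mat_carrier [simp]:
  "G1 \<in> carrier_mat m m \<Longrightarrow> G2 \<in> carrier_mat m m \<Longrightarrow> loop_mat m \<tau> t G1 G2 \<in> carrier_mat m m"
  unfolding loop_mat_def by (intro add_carrier_mat smult_carrier_mat mult_carrier_mat[of _ m m] shift_mat_carrier)

text \<open>The identity shifts appear as indicators, so that continuity, holomorphy and conjugation
  of the loop can be checked entrywise.\<close>

lemma loop_mat_index:
  assumes "G1 \<in> carrier_mat m m" "G2 \<in> carrier_mat m m" "i < m" "j < m"
  shows "loop_mat m \<tau> t G1 G2 $$ (i, j) = (if i = j then 1 else 0) + complex_of_real \<tau> *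
    (\<Sum>k<m. (G1 $$ (i, k) + complex_of_real t * (if k = i then 1 else 0)) *
       (G2 $$ (k, j) + complex_of_real t * (if k = j then 1 else 0)))"
  using assms by (simp add: loop_mat_def shift_mat_def scalar_prod_def lessThan_atLeast0)

lemma shift_mat_zero: "G \<in> carrier_mat m m \<Longrightarrow> shift_mat m 0 G = G"
  by (intro eq_matI) (auto simp: shift_mat_def)

lemma shift_mat_mult_vec:
  assumes "G \<in> carrier_mat m m" "x \<in> carrier_vec m"
  shows "shift_mat m t G *\<^sub>v x = G *\<^sub>v x + complex_of_real t \<cdot>\<^sub>v x"
proof -
  have "(complex_of_real t \<cdot>\<^sub>m 1\<^sub>m m) *\<^sub>v x = complex_of_real t \<cdot>\<^sub>v x"
    using assms(2) by (intro eq_vecI) (auto simp: row_smult)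
  then show ?thesis
    unfolding shift_mat_def using assms by (subst add_mult_distrib_mat_vec[of _ m m]) auto
qed

lemma smult_mat_mult_vec:
  fixes A :: "'a :: comm_ring_1 mat"
  assumes "A \<in> carrier_mat n m" "x \<in> carrier_vec m"
  shows "(c \<cdot>\<^sub>m A) *\<^sub>v x = c \<cdot>\<^sub>v (A *\<^sub>v x)"
  using assms by (intro eq_vecI) (auto simp: row_smult)

lemma loop_mat_mult_vec:
  assumes "G1 \<in> carrier_mat m m" "G2 \<in> carrier_mat m m" "x \<in> carrier_vec m"
  shows "loop_mat m \<tau> t G1 G2 *\<^sub>v x =
    x + complex_of_real \<tau> \<cdot>\<^sub>v (shift_mat m t G1 *\<^sub>v (shift_mat m t G2 *\<^sub>v x))"
proof -
  note s = shift_mat_carrier[OF assms(1), of t] shift_mat_carrier[OF assms(2), of t]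
  have c: "shift_mat m t G1 * shift_mat m t G2 \<in> carrier_mat m m" using s by simp
  show ?thesis
    unfolding loop_mat_def using assms c
    by (subst add_mult_distrib_mat_vec[of _ m m])
      (auto simp: smult_mat_mult_vec[OF c assms(3)] assoc_mult_mat_vec[OF s assms(3)])
qed

text \<open>A kernel vector \<open>x\<close> together with \<open>y\<close>, the output of the
  second block, is a pair of signals circulating in the loop. If \<open>y\<close> were zero, the
  feedback equation would make \<open>x\<close> zero as well.\<close>

lemma det_loop_mat_eq_0E:
  assumes G: "G1 \<in> carrier_mat m m" "G2 \<in> carrier_mat m m" and "det (loop_mat m \<tau> t G1 G2) = 0"
  obtains x y where "x \<in> carrier_vec m" "y \<in> carrier_vec m" "x \<noteq> 0\<^sub>v m" "y \<noteq> 0\<^sub>v m"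
    "y = shift_mat m t G2 *\<^sub>v x" "x = complex_of_real (- \<tau>) \<cdot>\<^sub>v (shift_mat m t G1 *\<^sub>v y)"
proof -
  obtain x where x: "x \<in> carrier_vec m" "x \<noteq> 0\<^sub>v m" "loop_mat m \<tau> t G1 G2 *\<^sub>v x = 0\<^sub>v m"
    using assms det_0_iff_vec_prod_zero[OF loop_mat_carrier[OF G]] by blast
  define y where "y = shift_mat m t G2 *\<^sub>v x"
  note s = shift_mat_carrier[OF G(1), of t] shift_mat_carrier[OF G(2), of t]
  have y: "y \<in> carrier_vec m" using s x by (simp add: y_def)
  define z where "z = shift_mat m t G1 *\<^sub>v y"
  have z: "z \<in> carrier_vec m" using s y by (simp add: z_def)
  have eq: "x + complex_of_real \<tau> \<cdot>\<^sub>v z = 0\<^sub>v m"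
    using x(3) unfolding loop_mat_mult_vec[OF G x(1)] y_def z_def .
  have "x = complex_of_real (- \<tau>) \<cdot>\<^sub>v z"
  proof (rule eq_vecI)
    fix i assume "i < dim_vec (complex_of_real (- \<tau>) \<cdot>\<^sub>v z)"
    then have i: "i < m" using z by simp
    then have "(x + complex_of_real \<tau> \<cdot>\<^sub>v z) $ i = 0" unfolding eq by simp
    then show "x $ i = (complex_of_real (- \<tau>) \<cdot>\<^sub>v z) $ i" using i x z by (simp add: add_eq_0_iff2)
  qed (use x z in auto)
  then have xz: "x = complex_of_real (- \<tau>) \<cdot>\<^sub>v z" .
  have "y \<noteq> 0\<^sub>v m"
  proof
    assume "y = 0\<^sub>v m"
    then have "z = 0\<^sub>v m" using s by (auto simp: z_def intro!: eq_vecI)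
    then have "x = 0\<^sub>v m" unfolding xz by (intro eq_vecI) auto
    then show False using x by simp
  qed
  then show thesis using that[of x y] x y y_def z_def xz by blast
qed

text \<open>If \<open>x\<close> is a kernel vector for one order of the blocks, then the signal
  \<open>y\<close> is one for the other order. This makes the two index conditions
  interchangeable.\<close>

lemma det_loop_mat_swap:
  assumes G: "G1 \<in> carrier_mat m m" "G2 \<in> carrier_mat m m" and "det (loop_mat m \<tau> t G1 G2) = 0"
  shows "det (loop_mat m \<tau> t G2 G1) = 0"
proof -
  obtain x y where x: "x \<in> carrier_vec m" "y \<in> carrier_vec m" "x \<noteq> 0\<^sub>v m" "y \<noteq> 0\<^sub>v m"
    and y: "y = shift_mat m t G2 *\<^sub>v x" "x = complex_of_real (- \<tau>) \<cdot>\<^sub>v (shift_mat m t G1 *\<^sub>v y)"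
    using det_loop_mat_eq_0E[OF assms] .
  note s = shift_mat_carrier[OF G(1), of t] shift_mat_carrier[OF G(2), of t]
  define z where "z = shift_mat m t G1 *\<^sub>v y"
  have z: "z \<in> carrier_vec m" using s x by (simp add: z_def)
  have xz: "x = complex_of_real (- \<tau>) \<cdot>\<^sub>v z" using y(2) by (simp add: z_def)
  have "y = complex_of_real (- \<tau>) \<cdot>\<^sub>v (shift_mat m t G2 *\<^sub>v z)"
    using y(1) unfolding xz mult_mat_vec[OF s(2) z] .
  then have "loop_mat m \<tau> t G2 G1 *\<^sub>v y = 0\<^sub>v m"
    unfolding loop_mat_mult_vec[OF G(2,1) x(2)] z_def[symmetric]
    using s z x(2) by (intro eq_vecI) (auto dest!: arg_cong[of y _ "\<lambda>v. v $ i" for i])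
  then show ?thesis
    using det_0_iff_vec_prod_zero[OF loop_mat_carrier[OF G(2,1)]] x by blast
qed

text \<open>The last condition on \<open>t\<close> holds for \<open>t = 0\<close> and whenever \<open>2 * r\<^sup>2 \<le> 1\<close>, the two ways in which
  the lemma is applied.\<close>

lemma ofp_ifp_loop_trivial:
  assumes v: "x \<in> carrier_vec m" "y \<in> carrier_vec m" "a \<in> carrier_vec m" "b \<in> carrier_vec m"
    and y: "y = a + complex_of_real t \<cdot>\<^sub>v x"
    and x: "x = complex_of_real (- \<tau>) \<cdot>\<^sub>v (b + complex_of_real t \<cdot>\<^sub>v y)"
    and a: "r * sqnorm a \<le> Re (a \<bullet>c x)" and b: "n * sqnorm y \<le> Re (b \<bullet>c y)"
    and r: "0 \<le> r" "0 < n + r" and \<tau>: "0 \<le> \<tau>" "\<tau> \<le> 1" and t: "0 \<le> t" "t * (2 * r\<^sup>2) \<le> t"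
    and y0: "y \<noteq> 0\<^sub>v m"
  shows "x = 0\<^sub>v m"
proof (rule ccontr)
  assume x0: "x \<noteq> 0\<^sub>v m"
  define q where "q = Re (y \<bullet>c x)"
  define Y where "Y = sqnorm y"
  define X where "X = sqnorm x"
  have X: "0 < X" using x0 sqnorm_eq_0[OF v(1)] sqnorm_nonneg[of x] by (auto simp: X_def less_le)
  have Y0: "0 \<le> Y" by (simp add: Y_def sqnorm_nonneg)
  have "Re (a \<bullet>c x) = q - t * X"
    unfolding q_def X_def sqnorm_def using v
    by (subst y) (simp add: ip_add_left[of _ m] ip_smult_left[of _ m])
  moreover have "sqnorm a = Y - 2 * t * q + t\<^sup>2 * X"
  proof -
    have "a = y + complex_of_real (- t) \<cdot>\<^sub>v x" using v unfolding y by (intro eq_vecI) auto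
    then show ?thesis
      unfolding q_def X_def Y_def sqnorm_def using v Re_ip_commute[OF v(1,2)]
      by (simp add: ip_add_left[of _ m] ip_add_right[of _ m] ip_smult_left[of _ m] ip_smult_right[of _ m]
          power2_eq_square algebra_simps)
  qed
  ultimately have "r * (Y - 2 * t * q + t\<^sup>2 * X) \<le> q - t * X"
    using a by simp
  \<comment> \<open>This is the output bound of the second block with \<open>a = y - t x\<close>
    expanded. Its left side is nonnegative, which gives \<open>0 \<le> q\<close>.\<close>
  then have 1: "r * Y + t * (1 + r * t) * X \<le> q * (1 + 2 * t * r)"
    by (simp add: algebra_simps power2_eq_square)
  moreover have "0 \<le> r * Y + t * (1 + r * t) * X"
    using r t X Y0 by (intro add_nonneg_nonneg mult_nonneg_nonneg) auto
  ultimately have "0 \<le> q * (1 + 2 * t * r)" by (rule order_trans[rotated])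
  moreover have tr: "0 < 1 + 2 * t * r" using r t by (simp add: add_pos_nonneg)
  ultimately have q0: "0 \<le> q" by (simp add: zero_le_mult_iff)
  have "Re (x \<bullet>c y) = - \<tau> * (Re (b \<bullet>c y) + t * Y)"
    unfolding Y_def sqnorm_def using v
    by (subst x) (simp add: ip_add_left[of _ m] ip_smult_left[of _ m])
  then have q: "q = - \<tau> * (Re (b \<bullet>c y) + t * Y)"
    using Re_ip_commute[OF v(1,2)] by (simp add: q_def)
  have Yp: "0 < Y" using y0 sqnorm_eq_0[OF v(2)] Y0 by (auto simp: Y_def less_le)
  have \<tau>p: "0 < \<tau>"
  proof (rule ccontr)
    assume "\<not> 0 < \<tau>"
    then have "\<tau> = 0" using \<tau> by simp
    then have "x = 0\<^sub>v m" using v by (subst x) auto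
    then show False using x0 by simp
  qed
  \<comment> \<open>The input bound of the first block, with \<open>n > - r\<close>, limits
    \<open>q\<close> from above through the feedback equation. As \<open>q\<close> is nonnegative,
    the factor \<open>\<tau> \<le> 1\<close> can then be dropped from this limit.\<close>
  have "- r * Y < n * Y" using r Yp by (intro mult_strict_right_mono) auto
  then have "\<tau> * ((t - r) * Y) < \<tau> * (Re (b \<bullet>c y) + t * Y)"
    using b \<tau>p by (intro mult_strict_left_mono) (auto simp: Y_def algebra_simps)
  then have 2: "q < \<tau> * ((r - t) * Y)" using q by (simp add: algebra_simps)
  then have "0 < \<tau> * ((r - t) * Y)" using q0 by simp
  then have "0 < (r - t) * Y" using \<tau>p by (simp add: zero_less_mult_iff)
  then have "\<tau> * ((r - t) * Y) \<le> (r - t) * Y" using \<tau> by (simp add: mult_left_le_one_le)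
  with 2 have "q < (r - t) * Y" by simp
  then have "q * (1 + 2 * t * r) < (r - t) * Y * (1 + 2 * t * r)" using tr by (rule mult_strict_right_mono)
  with 1 have "r * Y + t * (1 + r * t) * X < (r - t) * Y * (1 + 2 * t * r)" by simp
  \<comment> \<open>Comparing both bounds on \<open>q\<close>, the terms \<open>r * Y\<close>
    cancel. The remainder multiplying \<open>Y\<close> is nonpositive because
    \<open>t * (2 * r\<^sup>2) \<le> t\<close>, and this contradicts the strict inequality.\<close>
  moreover have "(r - t) * Y * (1 + 2 * t * r) = r * Y + (t * (2 * r\<^sup>2) - t - 2 * t\<^sup>2 * r) * Y"
    by (simp add: algebra_simps power2_eq_square)
  moreover have "(t * (2 * r\<^sup>2) - t - 2 * t\<^sup>2 * r) * Y \<le> 0"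
  proof -
    have "0 \<le> 2 * t\<^sup>2 * r" using r by simp
    then have "t * (2 * r\<^sup>2) - t - 2 * t\<^sup>2 * r \<le> 0" using t by linarith
    then show ?thesis using Y0 by (rule mult_nonpos_nonneg)
  qed
  moreover have "0 \<le> t * (1 + r * t) * X" using t r X by simp
  ultimately show False by linarith
qed

lemma det_loop_mat_ofp_ifp:
  assumes G: "G1 \<in> carrier_mat m m" "G2 \<in> carrier_mat m m" and P: "ofp G2 r" "ifp G1 n"
    and r: "0 \<le> r" "0 < n + r" and \<tau>: "0 \<le> \<tau>" "\<tau> \<le> 1" and t: "0 \<le> t" "t * (2 * r\<^sup>2) \<le> t"
  shows "det (loop_mat m \<tau> t G1 G2) \<noteq> 0"
proof
  assume "det (loop_mat m \<tau> t G1 G2) = 0"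
  then obtain x y where x: "x \<in> carrier_vec m" "y \<in> carrier_vec m" "x \<noteq> 0\<^sub>v m" "y \<noteq> 0\<^sub>v m"
    and y: "y = shift_mat m t G2 *\<^sub>v x" "x = complex_of_real (- \<tau>) \<cdot>\<^sub>v (shift_mat m t G1 *\<^sub>v y)"
    using det_loop_mat_eq_0E[OF G] by metis
  have "x = 0\<^sub>v m"
  proof (rule ofp_ifp_loop_trivial[OF x(1,2) _ _ _ _ _ _ r \<tau> t x(4)])
    show "y = G2 *\<^sub>v x + complex_of_real t \<cdot>\<^sub>v x" using y(1) unfolding shift_mat_mult_vec[OF G(2) x(1)] .
    show "x = complex_of_real (- \<tau>) \<cdot>\<^sub>v (G1 *\<^sub>v y + complex_of_real t \<cdot>\<^sub>v y)"
      using y(2) unfolding shift_mat_mult_vec[OF G(1) x(2)] .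
  qed (use G x P in \<open>auto intro: ofpD ifpD\<close>)
  then show False using x by simp
qed

text \<open>After the shift both blocks are strictly passive. The second makes
  \<open>Re (y \<bullet>c x)\<close> positive, whereas negative feedback through the first makes it
  nonpositive.\<close>

lemma det_loop_mat_passive:
  assumes G: "G1 \<in> carrier_mat m m" "G2 \<in> carrier_mat m m" and P: "ifp G1 n1" "ifp G2 n2"
    and n: "0 < n1 + t" "0 < n2 + t" and \<tau>: "0 \<le> \<tau>"
  shows "det (loop_mat m \<tau> t G1 G2) \<noteq> 0"
proof
  assume "det (loop_mat m \<tau> t G1 G2) = 0"
  then obtain x y where x: "x \<in> carrier_vec m" "y \<in> carrier_vec m" "x \<noteq> 0\<^sub>v m" "y \<noteq> 0\<^sub>v m"
    and y: "y = shift_mat m t G2 *\<^sub>v x" "x = complex_of_real (- \<tau>) \<cdot>\<^sub>v (shift_mat m t G1 *\<^sub>v y)"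
    using det_loop_mat_eq_0E[OF G] by metis
  have sp: "0 < sqnorm v" if "v \<in> carrier_vec m" "v \<noteq> 0\<^sub>v m" for v
    using that sqnorm_eq_0[of v m] sqnorm_nonneg[of v] by (auto simp: less_le)
  have pos: "(n + t) * sqnorm v \<le> Re ((shift_mat m t A *\<^sub>v v) \<bullet>c v)"
    if "A \<in> carrier_mat m m" "ifp A n" "v \<in> carrier_vec m" for A n v
    unfolding shift_mat_mult_vec[OF that(1,3)] using ifpD[OF that(2,1,3)] that
    by (simp add: ip_add_left[of _ m] ip_smult_left[of _ m] algebra_simps sqnorm_def)
  have "0 < (n2 + t) * sqnorm x" using n sp x by simp
  also have "\<dots> \<le> Re (y \<bullet>c x)" unfolding y(1) using pos[OF G(2) P(2) x(1)] .
  also have "\<dots> = Re (x \<bullet>c y)" using x Re_ip_commute by blast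
  also have "\<dots> = - \<tau> * Re ((shift_mat m t G1 *\<^sub>v y) \<bullet>c y)"
    using x shift_mat_carrier[OF G(1), of t] by (subst y(2)) (simp add: ip_smult_left[of _ m])
  also have "\<dots> \<le> 0"
  proof -
    have "0 \<le> (n1 + t) * sqnorm y" using n sqnorm_nonneg by simp
    also have "\<dots> \<le> Re ((shift_mat m t G1 *\<^sub>v y) \<bullet>c y)" by (rule pos[OF G(1) P(1) x(2)])
    finally show ?thesis using \<tau> by simp
  qed
  finally show False by simp
qed

text \<open>If some \<open>\<rho>\<close> is nonnegative, its output bound is paired with the input
  bound of the other block; otherwise both \<open>\<nu>\<close> are positive and passivity applies.
  The threshold \<open>1 / 2\<close> ensures \<open>2 * r\<^sup>2 \<le> 1\<close>.\<close>

lemma det_loop_mat_indices: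
  assumes G: "G1 \<in> carrier_mat m m" "G2 \<in> carrier_mat m m"
    and P: "ifp G1 \<nu>1" "ofp G1 \<rho>1" "ifp G2 \<nu>2" "ofp G2 \<rho>2"
    and pos: "0 < \<nu>1 + \<rho>2" "0 < \<nu>2 + \<rho>1" and \<tau>: "0 \<le> \<tau>" "\<tau> \<le> 1"
    and t: "t = 0 \<or> 0 \<le> t \<and> \<rho>1 \<le> 1 / 2 \<and> \<rho>2 \<le> 1 / 2"
  shows "det (loop_mat m \<tau> t G2 G1) \<noteq> 0"
proof -
  have small: "t * (2 * r\<^sup>2) \<le> t" if "0 \<le> r" "t = 0 \<or> 0 \<le> t \<and> r \<le> 1 / 2" for r
  proof (cases "t = 0")
    case False
    have "r\<^sup>2 \<le> (1 / 2)\<^sup>2" using that False by (intro power_mono) auto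
    then show ?thesis using that by (intro mult_left_le) (auto simp: power2_eq_square)
  qed simp
  have t0: "0 \<le> t" using t by auto
  consider "0 \<le> \<rho>1" | "0 \<le> \<rho>2" | "0 < \<nu>1" "0 < \<nu>2" using pos by linarith
  then show ?thesis
  proof cases
    case 1
    then show ?thesis using t small
      by (intro det_loop_mat_ofp_ifp[OF G(2,1) P(2,3) _ pos(2) \<tau> t0]) auto
  next
    case 2
    then have "det (loop_mat m \<tau> t G1 G2) \<noteq> 0" using t small
      by (intro det_loop_mat_ofp_ifp[OF G P(4,1) _ pos(1) \<tau> t0]) auto
    then show ?thesis using det_loop_mat_swap[OF G(2,1)] by blast
  next
    case 3
    then show ?thesis using t0
      by (intro det_loop_mat_passive[OF G(2,1) P(3,1) _ _ \<tau>(1)]) auto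
  qed
qed

section \<open>Homotopies and the behaviour at infinity\<close>

lemma continuous_on_det:
  fixes M :: "'a :: topological_space \<Rightarrow> complex mat"
  assumes "\<And>p. p \<in> S \<Longrightarrow> M p \<in> carrier_mat n n"
    and "\<And>i j. i < n \<Longrightarrow> j < n \<Longrightarrow> continuous_on S (\<lambda>p. M p $$ (i, j))"
  shows "continuous_on S (\<lambda>p. det (M p))"
proof -
  have "continuous_on S (\<lambda>p. \<Sum>\<pi>\<in>{\<pi>. \<pi> permutes {0..<n}}. signof \<pi> * (\<Prod>i = 0..<n. M p $$ (i, \<pi> i)))"
    by (intro continuous_intros assms(2)) (auto simp: permutes_nat_less)
  then show ?thesis
    by (rule continuous_on_eq) (simp add: det_def'[OF assms(1)])
qed

lemma holomorphic_on_det: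
  assumes "\<And>p. p \<in> S \<Longrightarrow> M p \<in> carrier_mat n n"
    and "\<And>i j. i < n \<Longrightarrow> j < n \<Longrightarrow> (\<lambda>p. M p $$ (i, j)) holomorphic_on S"
  shows "(\<lambda>p. det (M p)) holomorphic_on S"
proof -
  have "(\<lambda>p. \<Sum>\<pi>\<in>{\<pi>. \<pi> permutes {0..<n}}. signof \<pi> * (\<Prod>i = 0..<n. M p $$ (i, \<pi> i))) holomorphic_on S"
    by (intro holomorphic_intros assms(2)) (auto simp: permutes_nat_less)
  then show ?thesis
    by (rule holomorphic_transform) (simp add: det_def'[OF assms(1)])
qed

text \<open>Projections of this zero set to either factor are again compact, hence closed, so the
  parameters without a zero form a relatively open set.\<close>

lemma zeros_in_product_compact:
  fixes g :: "'a :: {heine_borel, real_normed_vector} \<times> 'b :: {heine_borel, real_normed_vector} \<Rightarrow> complex"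
  assumes "compact A" "compact B" "continuous_on (A \<times> B) g"
  shows "compact {p \<in> A \<times> B. g p = 0}"
proof -
  have c: "compact (A \<times> B)" using assms(1,2) by (rule compact_Times)
  have "closed {p \<in> A \<times> B. g p = 0}"
    using continuous_closed_preimage_constant[OF assms(3) compact_imp_closed[OF c]] .
  then show ?thesis using c
    by (metis (no_types, lifting) compact_Int_closed inf.absorb2 mem_Collect_eq subsetI)
qed

text \<open>The parameters \<open>t\<close> at which some zero occurs form a compact set that misses
  \<open>0\<close>, and therefore misses a neighbourhood of \<open>0\<close>.\<close>

lemma nonvanishing_tube:
  fixes g :: "'a :: {heine_borel, real_normed_vector} \<times> real \<Rightarrow> complex"
  assumes C: "compact C" and g: "continuous_on (C \<times> {0..1}) g" and nz: "\<And>c. c \<in> C \<Longrightarrow> g (c, 0) \<noteq> 0"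
  obtains \<epsilon> where "0 < \<epsilon>" "\<And>c t. c \<in> C \<Longrightarrow> 0 \<le> t \<Longrightarrow> t \<le> \<epsilon> \<Longrightarrow> g (c, t) \<noteq> 0"
proof -
  let ?Z = "{p \<in> C \<times> {0..1}. g p = 0}"
  have "compact (snd ` ?Z)"
    using zeros_in_product_compact[OF C compact_Icc g] by (intro compact_continuous_image continuous_intros)
  then have "open (- snd ` ?Z)" by (simp add: compact_imp_closed open_Compl)
  moreover have "0 \<in> - snd ` ?Z" using nz by auto
  ultimately obtain e where e: "0 < e" "ball 0 e \<subseteq> - snd ` ?Z" by (meson openE)
  show thesis
  proof
    \<comment> \<open>Half the radius keeps \<open>t\<close> inside the open ball, and the bound
      \<open>1\<close> keeps it in the domain of continuity.\<close>
    show "0 < min 1 (e / 2)" using e by simp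
    fix c t assume c: "c \<in> C" and t: "0 \<le> t" "t \<le> min 1 (e / 2)"
    then have "t \<in> ball 0 e" using e by (auto simp: dist_real_def)
    then have "t \<notin> snd ` ?Z" using e(2) by (meson ComplD subsetD)
    then show "g (c, t) \<noteq> 0" using c t by force
  qed
qed

text \<open>The parameters \<open>k\<close> for which \<open>F k\<close> has no zero in the closed
  disc form a clopen subset of the unit interval containing \<open>1\<close>. Openness comes from
  compactness of the disc, closedness from Hurwitz's theorem inside and \<open>bd\<close> on the
  circle.\<close>

lemma disc_homotopy_nonvanishing:
  fixes F :: "real \<Rightarrow> complex \<Rightarrow> complex"
  assumes cont: "continuous_on ({0..1} \<times> cball 0 1) (\<lambda>(k, z). F k z)"
    and hol: "\<And>k. k \<in> {0..1} \<Longrightarrow> F k holomorphic_on ball 0 1"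
    and bd: "\<And>k z. k \<in> {0..1} \<Longrightarrow> norm z = 1 \<Longrightarrow> F k z \<noteq> 0"
    and one: "\<And>z. norm z \<le> 1 \<Longrightarrow> F 1 z \<noteq> 0"
    and z: "norm z \<le> 1"
  shows "F 0 z \<noteq> 0"
proof -
  define T where "T = {k \<in> {0..1}. \<forall>z\<in>cball 0 1. F k z \<noteq> 0}"
  let ?Z = "{p \<in> {0..1} \<times> cball 0 1. (case p of (k, z) \<Rightarrow> F k z) = 0}"
  have Tsub: "T \<subseteq> {0..1}" by (auto simp: T_def)
  have "compact (fst ` ?Z)"
    using zeros_in_product_compact[OF compact_Icc compact_cball cont]
    by (intro compact_continuous_image continuous_intros)
  then have "open (- fst ` ?Z)" by (simp add: compact_imp_closed open_Compl)
  moreover have "T = {0..1} \<inter> - fst ` ?Z" by (force simp: T_def)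
  ultimately have opn: "openin (top_of_set {0..1}) T" by (auto simp: openin_open)
  have "closed T"
    unfolding closed_sequential_limits
  proof (intro allI impI, elim conjE)
    fix k l assume k: "\<forall>n. k n \<in> T" and l: "k \<longlonglongrightarrow> l"
    have k01: "k n \<in> {0..1}" for n using k Tsub by auto
    have l01: "l \<in> {0..1}" using closed_sequentially[OF closed_atLeastAtMost _ l] k01 by blast
    have "F l z \<noteq> 0" if z: "z \<in> ball 0 1" for z
    proof (cases "F l constant_on ball 0 1")
      \<comment> \<open>Hurwitz's theorem excludes a constant limit. Here continuity carries the
        constant to the boundary point \<open>1\<close>, where \<open>F l\<close> does not
        vanish.\<close>
      case True
      then obtain c where c: "\<And>z. z \<in> ball 0 1 \<Longrightarrow> F l z = c" by (auto simp: constant_on_def)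
      have "continuous_on (cball 0 1) (F l)"
      proof -
        have "continuous_on (cball 0 1) (\<lambda>z :: complex. (l, z))" by (intro continuous_intros)
        then have "continuous_on (cball 0 1) (\<lambda>z. case (l, z) of (k, z) \<Rightarrow> F k z)"
          by (rule continuous_on_compose2[OF cont]) (use l01 in auto)
        then show ?thesis by simp
      qed
      then have "continuous_on (closure (ball 0 1)) (F l)" by simp
      then have "F l 1 = c"
        by (rule continuous_constant_on_closure) (use c in auto)
      then show ?thesis using bd[OF l01, of 1] c[OF z] by simp
    next
      case False
      show ?thesis
      proof (rule Hurwitz_no_zeros[of "ball 0 1" "\<lambda>n. F (k n)" "F l"])
        show "uniform_limit K (\<lambda>n. F (k n)) (F l) sequentially" if K: "compact K" "K \<subseteq> ball 0 1" for K
        proof (rule uniform_limitI)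
          fix e :: real assume e: "0 < e"
          have "uniformly_continuous_on ({0..1} \<times> cball 0 1) (\<lambda>(k, z). F k z)"
            by (intro compact_uniformly_continuous cont compact_Times compact_Icc compact_cball)
          then obtain d where d: "0 < d" and
            uc: "\<And>p p'. p \<in> {0..1} \<times> cball 0 1 \<Longrightarrow> p' \<in> {0..1} \<times> cball 0 1 \<Longrightarrow> dist p' p < d \<Longrightarrow>
              dist (case p' of (k, z) \<Rightarrow> F k z) (case p of (k, z) \<Rightarrow> F k z) < e"
            using e unfolding uniformly_continuous_on_def by metis
          have "\<forall>\<^sub>F n in sequentially. dist (k n) l < d" using l d by (rule tendstoD)
          then show "\<forall>\<^sub>F n in sequentially. \<forall>x\<in>K. dist (F (k n) x) (F l x) < e"
          proof eventually_elim
            case (elim n)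
            show ?case
            proof
              fix x assume "x \<in> K"
              then have "x \<in> cball 0 1" using K by auto
              then show "dist (F (k n) x) (F l x) < e"
                using uc[of "(l, x)" "(k n, x)"] k01[of n] l01 elim by (simp add: dist_Pair_Pair)
            qed
          qed
        qed
        show "F (k n) z \<noteq> 0" if "z \<in> ball 0 1" for n z
          using k that by (auto simp: T_def)
      qed (use hol k01 l01 False z in auto)
    qed
    then have "F l z \<noteq> 0" if "z \<in> cball 0 1" for z
      using bd[OF l01, of z] that by (cases "norm z = 1") auto
    then show "l \<in> T" using l01 by (auto simp: T_def)
  qed
  then have "closedin (top_of_set {0..1}) T"
    using Tsub closed_subset by blast
  moreover have "connected {0..1 :: real}" by (rule connected_Icc)
  moreover have "1 \<in> T" using one by (auto simp: T_def)
  ultimately have "T = {0..1}" using opn unfolding connected_clopen by blast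
  then have "0 \<in> T" by simp
  then show ?thesis using z by (auto simp: T_def)
qed

section \<open>Entrywise limits and critical gains at infinity\<close>

definition mat_lim :: "nat \<Rightarrow> ('a \<Rightarrow> complex mat) \<Rightarrow> complex mat \<Rightarrow> 'a filter \<Rightarrow> bool" where
  "mat_lim m G D F \<longleftrightarrow> (\<forall>w. G w \<in> carrier_mat m m) \<and> D \<in> carrier_mat m m \<and>
    (\<forall>i<m. \<forall>j<m. ((\<lambda>w. G w $$ (i, j)) \<longlongrightarrow> D $$ (i, j)) F)"

definition vec_lim :: "nat \<Rightarrow> ('a \<Rightarrow> complex vec) \<Rightarrow> complex vec \<Rightarrow> 'a filter \<Rightarrow> bool" where
  "vec_lim m x x0 F \<longleftrightarrow> (\<forall>w. x w \<in> carrier_vec m) \<and> x0 \<in> carrier_vec m \<and>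
    (\<forall>i<m. ((\<lambda>w. x w $ i) \<longlongrightarrow> x0 $ i) F)"

lemma vec_lim_const: "x \<in> carrier_vec m \<Longrightarrow> vec_lim m (\<lambda>_. x) x F"
  by (simp add: vec_lim_def)

lemma vec_lim_mult_mat_vec:
  assumes "mat_lim m G D F" "vec_lim m x x0 F"
  shows "vec_lim m (\<lambda>w. G w *\<^sub>v x w) (D *\<^sub>v x0) F"
proof -
  have e: "(A *\<^sub>v v) $ i = (\<Sum>j<m. A $$ (i, j) * v $ j)"
    if "A \<in> carrier_mat m m" "v \<in> carrier_vec m" "i < m" for A i and v :: "complex vec"
    using that by (auto simp: scalar_prod_def lessThan_atLeast0 intro!: sum.cong)
  have "((\<lambda>w. (G w *\<^sub>v x w) $ i) \<longlongrightarrow> (D *\<^sub>v x0) $ i) F" if i: "i < m" for i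
  proof -
    have "((\<lambda>w. \<Sum>j<m. G w $$ (i, j) * x w $ j) \<longlongrightarrow> (\<Sum>j<m. D $$ (i, j) * x0 $ j)) F"
      using assms i by (intro tendsto_intros) (auto simp: mat_lim_def vec_lim_def)
    moreover have "(G w *\<^sub>v x w) $ i = (\<Sum>j<m. G w $$ (i, j) * x w $ j)" for w
      using assms i by (intro e) (auto simp: mat_lim_def vec_lim_def)
    moreover have "(D *\<^sub>v x0) $ i = (\<Sum>j<m. D $$ (i, j) * x0 $ j)"
      using assms i by (intro e) (auto simp: mat_lim_def vec_lim_def)
    ultimately show ?thesis by (simp only:)
  qed
  moreover have "G w *\<^sub>v x w \<in> carrier_vec m" for w
    using assms by (auto simp: mat_lim_def vec_lim_def intro: mult_mat_vec_carrier)
  ultimately show ?thesis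
    using assms by (auto simp: mat_lim_def vec_lim_def intro: mult_mat_vec_carrier)
qed

lemma tendsto_Re_ip:
  assumes "vec_lim m x x0 F" "vec_lim m y y0 F"
  shows "((\<lambda>w. Re (x w \<bullet>c y w)) \<longlongrightarrow> Re (x0 \<bullet>c y0)) F"
proof -
  have "((\<lambda>w. Re (\<Sum>i<m. x w $ i * cnj (y w $ i))) \<longlongrightarrow> Re (\<Sum>i<m. x0 $ i * cnj (y0 $ i))) F"
    using assms by (intro tendsto_intros) (auto simp: vec_lim_def)
  then show ?thesis using assms by (simp add: vec_lim_def cscalar_prod_sum[of _ m])
qed

lemma tendsto_sqnorm: "vec_lim m x x0 F \<Longrightarrow> ((\<lambda>w. sqnorm (x w)) \<longlongrightarrow> sqnorm x0) F"
  unfolding sqnorm_def by (rule tendsto_Re_ip)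

text \<open>Testing both index bounds with $G_2(\omega) x$, which tends to \<open>y\<close>, and passing to the limit gives
  $(1 - l)\,\mathrm{Re}\langle y, x\rangle \ge 0$.\<close>

lemma critical_inner_product_le:
  assumes lim: "mat_lim m G1 D1 F" "mat_lim m G2 D2 F" and F: "F \<noteq> bot"
    and P: "\<forall>\<^sub>F w in F. ifp (G1 w) (\<nu> w) \<and> ofp (G2 w) (\<rho> w) \<and> 0 < \<nu> w + \<rho> w"
    and x: "x \<in> carrier_vec m" and y: "y = D2 *\<^sub>v x" and D1y: "D1 *\<^sub>v y = complex_of_real (- l) \<cdot>\<^sub>v x"
    and l: "1 < l"
  shows "Re (y \<bullet>c x) \<le> 0"
proof -
  note D = lim[unfolded mat_lim_def]
  have yc: "y \<in> carrier_vec m" using D x by (auto simp: y intro: mult_mat_vec_carrier)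
  define Y where "Y w = G2 w *\<^sub>v x" for w
  have Yl: "vec_lim m Y y F" unfolding Y_def y by (rule vec_lim_mult_mat_vec[OF lim(2) vec_lim_const[OF x]])
  then have Yc: "Y w \<in> carrier_vec m" for w by (simp add: vec_lim_def)
  have "((\<lambda>w. Re ((G1 w *\<^sub>v Y w) \<bullet>c Y w) + Re (Y w \<bullet>c x)) \<longlongrightarrow> Re ((D1 *\<^sub>v y) \<bullet>c y) + Re (y \<bullet>c x)) F"
    by (intro tendsto_add tendsto_Re_ip[of m] vec_lim_mult_mat_vec Yl lim vec_lim_const x)
  moreover have "\<forall>\<^sub>F w in F. 0 \<le> Re ((G1 w *\<^sub>v Y w) \<bullet>c Y w) + Re (Y w \<bullet>c x)"
    using P
  proof eventually_elim
    case (elim w)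
    have "0 \<le> (\<nu> w + \<rho> w) * sqnorm (Y w)" using elim sqnorm_nonneg by simp
    also have "\<dots> = \<nu> w * sqnorm (Y w) + \<rho> w * sqnorm (Y w)" by (simp add: algebra_simps)
    also have "\<dots> \<le> Re ((G1 w *\<^sub>v Y w) \<bullet>c Y w) + Re (Y w \<bullet>c x)"
      using elim D x Yc unfolding Y_def by (intro add_mono ifpD[of _ _ m] ofpD[of _ _ m]) auto
    finally show ?case .
  qed
  ultimately have "0 \<le> Re ((D1 *\<^sub>v y) \<bullet>c y) + Re (y \<bullet>c x)" by (rule tendsto_lowerbound[OF _ _ F])
  also have "Re ((D1 *\<^sub>v y) \<bullet>c y) = - l * Re (y \<bullet>c x)"
    unfolding D1y using x yc Re_ip_commute[OF x yc] by (simp add: ip_smult_left[of _ m])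
  finally have "0 \<le> (1 - l) * Re (y \<bullet>c x)" by (simp add: algebra_simps)
  then show ?thesis using l by (simp add: zero_le_mult_iff)
qed

text \<open>Tested at \<open>x\<close>, the output bound has a right side tending to
  \<open>0\<close>, while \<open>sqnorm (G2 w *\<^sub>v x)\<close> tends to a positive number. So
  \<open>\<rho>\<close> is eventually below every positive number, \<open>\<nu>\<close> is
  eventually above every negative one, and the input bound survives in the limit with index
  \<open>0\<close>.\<close>

lemma critical_indices_limit:
  assumes lim: "mat_lim m G1 D1 F" "mat_lim m G2 D2 F" and F: "F \<noteq> bot"
    and P: "\<forall>\<^sub>F w in F. ifp (G1 w) (\<nu> w) \<and> ofp (G2 w) (\<rho> w) \<and> 0 < \<nu> w + \<rho> w"
    and x: "x \<in> carrier_vec m" and y: "y = D2 *\<^sub>v x" "y \<noteq> 0\<^sub>v m" and q: "Re (y \<bullet>c x) = 0"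
  shows "\<forall>\<^sub>F w in F. \<rho> w \<le> 1 / 2" and "ifp D1 0"
proof -
  note D = lim[unfolded mat_lim_def]
  have yc: "y \<in> carrier_vec m" using D x by (auto simp: y intro: mult_mat_vec_carrier)
  have y0: "0 < sqnorm y" using sqnorm_eq_0[OF yc] y(2) sqnorm_nonneg[of y] by (auto simp: less_le)
  have Yl: "vec_lim m (\<lambda>w. G2 w *\<^sub>v x) y F" unfolding y by (rule vec_lim_mult_mat_vec[OF lim(2) vec_lim_const[OF x]])
  have ev: "\<forall>\<^sub>F w in F. \<rho> w \<le> e" if e: "0 < e" for e
  proof -
    have "((\<lambda>w. Re ((G2 w *\<^sub>v x) \<bullet>c x) - e * sqnorm (G2 w *\<^sub>v x)) \<longlongrightarrow> Re (y \<bullet>c x) - e * sqnorm y) F"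
      by (intro tendsto_intros tendsto_Re_ip[of m] tendsto_sqnorm[of m] Yl vec_lim_const x)
    then have "\<forall>\<^sub>F w in F. Re ((G2 w *\<^sub>v x) \<bullet>c x) - e * sqnorm (G2 w *\<^sub>v x) < 0"
      by (rule order_tendstoD) (use q e y0 in simp)
    with P show ?thesis
    proof eventually_elim
      case (elim w)
      have "\<rho> w * sqnorm (G2 w *\<^sub>v x) \<le> Re ((G2 w *\<^sub>v x) \<bullet>c x)"
        using elim D x by (intro ofpD[of _ _ m]) auto
      also have "\<dots> < e * sqnorm (G2 w *\<^sub>v x)" using elim by simp
      finally show ?case using sqnorm_nonneg[of "G2 w *\<^sub>v x"] by (smt (verit) mult_right_mono)
    qed
  qed
  from ev[of "1 / 2"] show "\<forall>\<^sub>F w in F. \<rho> w \<le> 1 / 2" by simp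
  have "0 \<le> Re ((D1 *\<^sub>v z) \<bullet>c z)" if z: "z \<in> carrier_vec m" for z
  proof (rule field_le_epsilon)
    fix e :: real assume e: "0 < e"
    \<comment> \<open>The summand \<open>1\<close> keeps the denominator positive when
      \<open>z\<close> is zero.\<close>
    define d where "d = e / (1 + sqnorm z)"
    have d: "0 < d" "d * sqnorm z \<le> e" using e sqnorm_nonneg[of z] by (auto simp: d_def field_simps)
    have "((\<lambda>w. Re ((G1 w *\<^sub>v z) \<bullet>c z)) \<longlongrightarrow> Re ((D1 *\<^sub>v z) \<bullet>c z)) F"
      by (intro tendsto_Re_ip[of m] vec_lim_mult_mat_vec lim vec_lim_const z)
    moreover have "\<forall>\<^sub>F w in F. - e \<le> Re ((G1 w *\<^sub>v z) \<bullet>c z)"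
      using P ev[OF d(1)]
    proof eventually_elim
      case (elim w)
      have "- d * sqnorm z \<le> \<nu> w * sqnorm z" using elim sqnorm_nonneg by (intro mult_right_mono) auto
      also have "\<dots> \<le> Re ((G1 w *\<^sub>v z) \<bullet>c z)" using elim D z by (intro ifpD[of _ _ m]) auto
      finally show ?case using d by simp
    qed
    ultimately have "- e \<le> Re ((D1 *\<^sub>v z) \<bullet>c z)" by (rule tendsto_lowerbound[OF _ _ F])
    then show "0 \<le> Re ((D1 *\<^sub>v z) \<bullet>c z) + e" by simp
  qed
  then show "ifp D1 0" using D by (auto simp: ifp_def)
qed

text \<open>A kernel vector at a gain \<open>\<tau> < 1\<close> satisfies \<open>D1 x = y\<close>
  and \<open>D2 y = - l x\<close> with \<open>l = 1 / \<tau> > 1\<close>. Applying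
  \<open>critical_inner_product_le\<close> from \<open>x\<close> and from \<open>y\<close> gives
  opposite signs for the same inner product, so it vanishes and
  \<open>critical_indices_limit\<close> applies in both orders.\<close>

lemma critical_loop:
  assumes lim: "mat_lim m G1 D1 F" "mat_lim m G2 D2 F" and F: "F \<noteq> bot"
    and P12: "\<forall>\<^sub>F w in F. ifp (G1 w) (\<nu>1 w) \<and> ofp (G2 w) (\<rho>2 w) \<and> 0 < \<nu>1 w + \<rho>2 w"
    and P21: "\<forall>\<^sub>F w in F. ifp (G2 w) (\<nu>2 w) \<and> ofp (G1 w) (\<rho>1 w) \<and> 0 < \<nu>2 w + \<rho>1 w"
    and \<tau>: "0 \<le> \<tau>" "\<tau> < 1" and crit: "det (loop_mat m \<tau> 0 D2 D1) = 0"
  shows "\<forall>\<^sub>F w in F. \<rho>1 w \<le> 1 / 2 \<and> \<rho>2 w \<le> 1 / 2" and "ifp D1 0" and "ifp D2 0"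
proof -
  have D: "D1 \<in> carrier_mat m m" "D2 \<in> carrier_mat m m" using lim by (auto simp: mat_lim_def)
  obtain x y where x: "x \<in> carrier_vec m" "y \<in> carrier_vec m" "x \<noteq> 0\<^sub>v m" "y \<noteq> 0\<^sub>v m"
    and y: "y = D1 *\<^sub>v x" and xy: "x = complex_of_real (- \<tau>) \<cdot>\<^sub>v (D2 *\<^sub>v y)"
    using det_loop_mat_eq_0E[OF D(2,1) crit] shift_mat_zero D by metis
  have "\<tau> \<noteq> 0"
  proof
    assume "\<tau> = 0"
    then have "x = 0\<^sub>v m" using D by (subst xy) (auto intro!: eq_vecI)
    then show False using x by simp
  qed
  define l where "l = 1 / \<tau>"
  have l: "1 < l" "\<tau> * l = 1" using \<tau> \<open>\<tau> \<noteq> 0\<close> by (auto simp: l_def)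
  have D2y: "D2 *\<^sub>v y = complex_of_real (- l) \<cdot>\<^sub>v x"
  proof -
    have "complex_of_real (- l) \<cdot>\<^sub>v x = complex_of_real (\<tau> * l) \<cdot>\<^sub>v (D2 *\<^sub>v y)"
      by (subst xy) (simp add: smult_smult_assoc mult.commute)
    then show ?thesis unfolding l by simp
  qed
  let ?x' = "D2 *\<^sub>v y"
  have x': "?x' \<in> carrier_vec m" using D x by simp
  have D1x': "D1 *\<^sub>v ?x' = complex_of_real (- l) \<cdot>\<^sub>v y"
    by (simp only: D2y mult_mat_vec[OF D(1) x(1)] y[symmetric])
  have 1: "Re (y \<bullet>c x) \<le> 0"
    using critical_inner_product_le[OF lim(2,1) F P21 x(1) y D2y l(1)] .
  have 2: "Re (?x' \<bullet>c y) \<le> 0"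
    using critical_inner_product_le[OF lim F P12 x(2) refl D1x' l(1)] .
  have "Re (?x' \<bullet>c y) = - l * Re (y \<bullet>c x)"
    unfolding D2y using x Re_ip_commute[OF x(1,2)] by (simp add: ip_smult_left[of _ m])
  moreover from this have "0 \<le> l * Re (y \<bullet>c x)" using 2 by simp
  then have "0 \<le> Re (y \<bullet>c x)" using l by (simp add: zero_le_mult_iff)
  ultimately have q: "Re (y \<bullet>c x) = 0" "Re (?x' \<bullet>c y) = 0" using 1 by simp_all
  have "?x' \<noteq> 0\<^sub>v m"
  proof
    assume z: "?x' = 0\<^sub>v m"
    have "x = 0\<^sub>v m" by (subst xy) (auto simp: z intro!: eq_vecI)
    then show False using x by simp
  qed
  note A = critical_indices_limit[OF lim(2,1) F P21 x(1) y x(4) q(1)]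
    and B = critical_indices_limit[OF lim F P12 x(2) refl this q(2)]
  show "\<forall>\<^sub>F w in F. \<rho>1 w \<le> 1 / 2 \<and> \<rho>2 w \<le> 1 / 2" using A(1) B(1) by (rule eventually_conj)
  show "ifp D1 0" "ifp D2 0" by (rule A B)+
qed

section \<open>The loop on the closed right half plane\<close>

lemma continuous_on_det_loop_mat:
  fixes A B :: "'a :: topological_space \<Rightarrow> complex mat"
  assumes c: "\<And>p. A p \<in> carrier_mat m m" "\<And>p. B p \<in> carrier_mat m m"
    and A: "\<And>i j. i < m \<Longrightarrow> j < m \<Longrightarrow> continuous_on S (\<lambda>p. A p $$ (i, j))"
    and B: "\<And>i j. i < m \<Longrightarrow> j < m \<Longrightarrow> continuous_on S (\<lambda>p. B p $$ (i, j))"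
    and \<tau>: "continuous_on S \<tau>" and t: "continuous_on S t"
  shows "continuous_on S (\<lambda>p. det (loop_mat m (\<tau> p) (t p) (A p) (B p)))"
proof (rule continuous_on_det[of _ _ m])
  fix i j assume "i < m" "j < m"
  then show "continuous_on S (\<lambda>p. loop_mat m (\<tau> p) (t p) (A p) (B p) $$ (i, j))"
    unfolding loop_mat_index[OF c \<open>i < m\<close> \<open>j < m\<close>] by (intro continuous_intros A B \<tau> t) auto
qed (simp add: c)

lemma holomorphic_on_det_loop_mat:
  assumes c: "\<And>p. A p \<in> carrier_mat m m" "\<And>p. B p \<in> carrier_mat m m"
    and A: "\<And>i j. i < m \<Longrightarrow> j < m \<Longrightarrow> (\<lambda>p. A p $$ (i, j)) holomorphic_on S"
    and B: "\<And>i j. i < m \<Longrightarrow> j < m \<Longrightarrow> (\<lambda>p. B p $$ (i, j)) holomorphic_on S"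
  shows "(\<lambda>p. det (loop_mat m \<tau> t (A p) (B p))) holomorphic_on S"
proof (rule holomorphic_on_det[of _ _ m])
  fix i j assume "i < m" "j < m"
  then show "(\<lambda>p. loop_mat m \<tau> t (A p) (B p) $$ (i, j)) holomorphic_on S"
    unfolding loop_mat_index[OF c \<open>i < m\<close> \<open>j < m\<close>] by (intro holomorphic_intros A B) auto
qed (simp add: c)

lemma loop_mat_zero:
  assumes "A \<in> carrier_mat m m" "B \<in> carrier_mat m m"
  shows "loop_mat m 0 t A B = 1\<^sub>m m"
  using loop_mat_carrier[OF assms, of 0 t]
  by (intro eq_matI) (auto simp: loop_mat_index[OF assms])

lemma loop_mat_unshifted:
  assumes "A \<in> carrier_mat m m" "B \<in> carrier_mat m m"
  shows "loop_mat m 1 0 A B = 1\<^sub>m m + A * B"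
  unfolding loop_mat_def using assms by (intro eq_matI) (auto simp: shift_mat_zero)

text \<open>All scalars of the loop are real. Since transfer functions have real coefficients, this
  reduces negative frequencies to positive ones.\<close>

lemma det_loop_mat_cnj:
  assumes AB: "A \<in> carrier_mat m m" "B \<in> carrier_mat m m"
  shows "det (loop_mat m \<tau> t (map_mat cnj A) (map_mat cnj B)) = cnj (det (loop_mat m \<tau> t A B))"
proof -
  interpret cnj: comm_ring_hom cnj by unfold_locales auto
  have c: "map_mat cnj A \<in> carrier_mat m m" "map_mat cnj B \<in> carrier_mat m m" using AB by simp_all
  have "loop_mat m \<tau> t (map_mat cnj A) (map_mat cnj B) = map_mat cnj (loop_mat m \<tau> t A B)"
  proof (rule eq_matI)
    fix i j
    assume "i < dim_row (map_mat cnj (loop_mat m \<tau> t A B))" "j < dim_col (map_mat cnj (loop_mat m \<tau> t A B))"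
    then have ij: "i < m" "j < m" using loop_mat_carrier[OF AB, of \<tau> t] by auto
    show "loop_mat m \<tau> t (map_mat cnj A) (map_mat cnj B) $$ (i, j) = map_mat cnj (loop_mat m \<tau> t A B) $$ (i, j)"
      using ij AB carrier_matD[OF loop_mat_carrier[OF AB, of \<tau> t]]
      by (simp add: loop_mat_index[OF c] loop_mat_index[OF AB] if_distrib[of cnj] cong: if_cong)
  qed (use loop_mat_carrier[OF AB, of \<tau> t] loop_mat_carrier[OF c, of \<tau> t] in auto)
  then show ?thesis by simp
qed

text \<open>In the critical case the frequency axis is split at \<open>W\<close>: beyond it the
  small output indices allow every nonnegative shift, and on the compact remainder the unshifted
  loop is nonsingular, so small shifts are harmless.\<close>

lemma det_loop_mat_shift_interval:
  fixes G1 G2 :: "real \<Rightarrow> complex mat"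
  assumes lim: "mat_lim m G1 D1 at_top" "mat_lim m G2 D2 at_top"
    and cont: "\<And>i j. i < m \<Longrightarrow> j < m \<Longrightarrow> continuous_on {0..} (\<lambda>w. G1 w $$ (i, j))"
      "\<And>i j. i < m \<Longrightarrow> j < m \<Longrightarrow> continuous_on {0..} (\<lambda>w. G2 w $$ (i, j))"
    and P: "\<And>w. 0 \<le> w \<Longrightarrow> ifp (G1 w) (\<nu>1 w)" "\<And>w. 0 \<le> w \<Longrightarrow> ofp (G1 w) (\<rho>1 w)"
      "\<And>w. 0 \<le> w \<Longrightarrow> ifp (G2 w) (\<nu>2 w)" "\<And>w. 0 \<le> w \<Longrightarrow> ofp (G2 w) (\<rho>2 w)"
    and pos: "\<And>w. 0 \<le> w \<Longrightarrow> 0 < \<nu>1 w + \<rho>2 w" "\<And>w. 0 \<le> w \<Longrightarrow> 0 < \<nu>2 w + \<rho>1 w"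
    and nz: "det (loop_mat m 1 0 D2 D1) \<noteq> 0"
  obtains \<epsilon> where "0 \<le> \<epsilon>"
    "\<And>w \<tau> t. 0 \<le> w \<Longrightarrow> 0 \<le> \<tau> \<Longrightarrow> \<tau> \<le> 1 \<Longrightarrow> 0 \<le> t \<Longrightarrow> t \<le> \<epsilon> \<Longrightarrow> det (loop_mat m \<tau> t (G2 w) (G1 w)) \<noteq> 0"
    "\<And>k. 0 \<le> k \<Longrightarrow> k \<le> 1 \<Longrightarrow> det (loop_mat m (1 - k) (\<epsilon> * k) D2 D1) \<noteq> 0"
proof -
  have G: "G1 w \<in> carrier_mat m m" "G2 w \<in> carrier_mat m m" for w using lim by (auto simp: mat_lim_def)
  have D: "D1 \<in> carrier_mat m m" "D2 \<in> carrier_mat m m" using lim by (auto simp: mat_lim_def)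
  have nz0: "det (loop_mat m \<tau> t (G2 w) (G1 w)) \<noteq> 0"
    if "0 \<le> w" "0 \<le> \<tau>" "\<tau> \<le> 1" "t = 0 \<or> 0 \<le> t \<and> \<rho>1 w \<le> 1 / 2 \<and> \<rho>2 w \<le> 1 / 2" for w \<tau> t
    using that by (intro det_loop_mat_indices[OF G P pos]) auto
  show thesis
  proof (cases "\<forall>\<tau>\<in>{0..1}. det (loop_mat m \<tau> 0 D2 D1) \<noteq> 0")
    case True
    then show ?thesis using nz0 by (intro that[of 0]) auto
  next
    case False
    then obtain \<tau> where \<tau>: "0 \<le> \<tau>" "\<tau> \<le> 1" "det (loop_mat m \<tau> 0 D2 D1) = 0" by auto
    then have \<tau>1: "\<tau> < 1" using nz by (cases "\<tau> = 1") auto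
    have ev12: "\<forall>\<^sub>F w in at_top. ifp (G1 w) (\<nu>1 w) \<and> ofp (G2 w) (\<rho>2 w) \<and> 0 < \<nu>1 w + \<rho>2 w"
      by (rule eventually_mono[OF eventually_ge_at_top[of 0]]) (use P pos in blast)
    have ev21: "\<forall>\<^sub>F w in at_top. ifp (G2 w) (\<nu>2 w) \<and> ofp (G1 w) (\<rho>1 w) \<and> 0 < \<nu>2 w + \<rho>1 w"
      by (rule eventually_mono[OF eventually_ge_at_top[of 0]]) (use P pos in blast)
    note crit = critical_loop[OF lim trivial_limit_at_top_linorder ev12 ev21 \<tau>(1) \<tau>1 \<tau>(3)]
    obtain W where W: "\<And>w. W \<le> w \<Longrightarrow> \<rho>1 w \<le> 1 / 2 \<and> \<rho>2 w \<le> 1 / 2"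
      using crit(1) unfolding eventually_at_top_linorder by blast
    let ?g = "\<lambda>p :: (real \<times> real) \<times> real. det (loop_mat m (fst (fst p)) (snd p) (G2 (snd (fst p))) (G1 (snd (fst p))))"
    have g: "continuous_on (({0..1} \<times> {0..W}) \<times> {0..1}) ?g"
      by (intro continuous_on_det_loop_mat G continuous_on_compose2[OF cont(1)] continuous_on_compose2[OF cont(2)]
          continuous_intros) auto
    have g0: "?g (c, 0) \<noteq> 0" if "c \<in> {0..1} \<times> {0..W}" for c
      using that nz0[of "snd c" "fst c" 0] by auto
    obtain \<epsilon> where \<epsilon>: "0 < \<epsilon>" "\<And>c t. c \<in> {0..1} \<times> {0..W} \<Longrightarrow> 0 \<le> t \<Longrightarrow> t \<le> \<epsilon> \<Longrightarrow> ?g (c, t) \<noteq> 0"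
      using nonvanishing_tube[OF compact_Times[OF compact_Icc compact_Icc] g g0] by blast
    show ?thesis
    proof (rule that[of \<epsilon>])
      fix w s t :: real assume a: "0 \<le> w" "0 \<le> s" "s \<le> 1" "0 \<le> t" "t \<le> \<epsilon>"
      show "det (loop_mat m s t (G2 w) (G1 w)) \<noteq> 0"
      proof (cases "w \<le> W")
        case True
        then show ?thesis using \<epsilon>(2)[of "(s, w)" t] a by simp
      next
        case False
        then show ?thesis using W[of w] a by (intro nz0) auto
      qed
    next
      fix k :: real assume k: "0 \<le> k" "k \<le> 1"
      show "det (loop_mat m (1 - k) (\<epsilon> * k) D2 D1) \<noteq> 0"
      \<comment> \<open>At \<open>k = 0\<close> there is no shift and only \<open>nz\<close> helps;
        for \<open>k > 0\<close> the shift turns the index \<open>0\<close> of both limits into a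
        positive one.\<close>
      proof (cases "k = 0")
        case False
        then show ?thesis using k \<epsilon>(1)
          by (intro det_loop_mat_passive[OF D(2,1) crit(3,2)]) auto
      qed (use nz in simp)
    qed (use \<epsilon> in simp)
  qed
qed

section \<open>The Cayley transform from the closed unit disc without \<open>1\<close> onto the
  closed right half plane\<close>

definition cayley :: "complex \<Rightarrow> complex" where
  "cayley z = (1 + z) / (1 - z)"

text \<open>At \<open>z = 1\<close> both sides are \<open>0\<close> by division by zero, so the two
  consequences below hold there without a side condition.\<close>

lemma Re_cayley: "Re (cayley z) = (1 - (cmod z)\<^sup>2) / (cmod (1 - z))\<^sup>2"
  unfolding cayley_def Re_divide cmod_power2
  by (simp add: power2_eq_square algebra_simps)

lemma Re_cayley_nonneg: "cmod z \<le> 1 \<Longrightarrow> 0 \<le> Re (cayley z)"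
  by (simp add: Re_cayley power_le_one)

lemma cayley_imaginary: "cmod z = 1 \<Longrightarrow> cayley z = \<i> * complex_of_real (Im (cayley z))"
  using Re_cayley[of z] by (simp add: complex_eq_iff)

lemma cayley_surj:
  assumes "0 \<le> Re s"
  obtains z where "cmod z \<le> 1" "z \<noteq> 1" "cayley z = s"
proof
  let ?z = "(s - 1) / (s + 1)"
  have s: "s + 1 \<noteq> 0" using assms by (auto simp: complex_eq_iff)
  have "(cmod (s - 1))\<^sup>2 \<le> (cmod (s + 1))\<^sup>2"
    using assms unfolding cmod_power2 by (simp add: power2_eq_square algebra_simps)
  then have "cmod (s - 1) \<le> cmod (s + 1)" by (rule power2_le_imp_le) simp
  then show "cmod ?z \<le> 1" using s by (simp add: norm_divide divide_le_eq_1)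
  show "?z \<noteq> 1" using s by (simp add: divide_eq_eq)
  have "1 + ?z = 2 * s / (s + 1)" "1 - ?z = 2 / (s + 1)" using s by (simp_all add: field_simps)
  then show "cayley ?z = s" unfolding cayley_def using s by simp
qed

lemma cayley_at_infinity: "filterlim cayley at_infinity (at 1)"
  unfolding cayley_def[abs_def]
proof (rule filterlim_divide_at_infinity)
  show "((\<lambda>z :: complex. 1 + z) \<longlongrightarrow> 2) (at 1)" by (auto intro!: tendsto_eq_intros)
  show "filterlim (\<lambda>z :: complex. 1 - z) (at 0) (at 1)"
    unfolding filterlim_at by (auto simp: eventually_at_filter intro!: tendsto_eq_intros)
qed simp

lemma eval_ratfun_isCont:
  assumes "regular_at q s"
  shows "isCont (eval_ratfun q) s"
proof -
  have "isCont (cpoly p) s" for p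
    unfolding cpoly_def[abs_def] by (intro continuous_intros)
  then show ?thesis
    unfolding eval_ratfun_eq[abs_def] using assms by (intro continuous_intros) (auto simp: regular_at_iff)
qed

text \<open>The point \<open>1\<close> corresponds to infinity and receives the limit value
  explicitly, because \<open>cayley 1\<close> is the default \<open>0\<close>.\<close>

definition disc_tf :: "ratfun mat \<Rightarrow> complex mat \<Rightarrow> complex \<Rightarrow> complex mat" where
  "disc_tf H D z = (if z = 1 then D else eval_tf H (cayley z))"

lemma disc_tf_carrier:
  "H \<in> carrier_mat m m \<Longrightarrow> D \<in> carrier_mat m m \<Longrightarrow> disc_tf H D z \<in> carrier_mat m m"
  by (simp add: disc_tf_def eval_tf_carrier)

lemma disc_tf_continuous_on:
  assumes H: "H \<in> carrier_mat m m" and reg: "\<And>s. 0 \<le> Re s \<Longrightarrow> regular_mat_at H s"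
    and lim: "((\<lambda>s. eval_tf H s $$ (i, j)) \<longlongrightarrow> D $$ (i, j)) at_infinity" and ij: "i < m" "j < m"
  shows "continuous_on (cball 0 1) (\<lambda>z. disc_tf H D z $$ (i, j))"
  unfolding continuous_on_eq_continuous_within
proof
  let ?q = "H $$ (i, j)"
  let ?f = "\<lambda>z. disc_tf H D z $$ (i, j)"
  fix z assume z: "z \<in> cball (0 :: complex) 1"
  show "continuous (at z within cball 0 1) ?f"
  \<comment> \<open>Unrestricted continuity is available at every point of the closed disc: at
    \<open>1\<close> because the limit at infinity is taken in all directions, elsewhere because
    \<open>cayley z\<close> is a regular point.\<close>
  proof (rule continuous_at_imp_continuous_at_within, cases "z = 1")
    case True
    have "((\<lambda>z. eval_tf H (cayley z) $$ (i, j)) \<longlongrightarrow> D $$ (i, j)) (at 1)"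
      by (rule filterlim_compose[OF lim cayley_at_infinity])
    then have "(?f \<longlongrightarrow> D $$ (i, j)) (at 1)"
      by (rule Lim_transform_eventually) (auto simp: disc_tf_def eventually_at_filter)
    then show "isCont ?f z" by (simp add: isCont_def True disc_tf_def)
  next
    case False
    have "regular_at ?q (cayley z)"
      using z H ij by (intro regular_mat_atD reg Re_cayley_nonneg) auto
    moreover have "isCont cayley z" unfolding cayley_def[abs_def] using False by (intro continuous_intros) auto
    ultimately have "isCont (\<lambda>z. eval_ratfun ?q (cayley z)) z"
      using isCont_o2 eval_ratfun_isCont by blast
    moreover have "\<forall>\<^sub>F w in nhds z. ?f w = eval_ratfun ?q (cayley w)"
      using t1_space_nhds[OF False] by eventually_elim (use H ij in \<open>auto simp: disc_tf_def eval_tf_def\<close>)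
    ultimately show "isCont ?f z" by (simp add: isCont_cong)
  qed
qed

lemma disc_tf_holomorphic_on:
  assumes H: "H \<in> carrier_mat m m" and reg: "\<And>s. 0 \<le> Re s \<Longrightarrow> regular_mat_at H s" and ij: "i < m" "j < m"
  shows "(\<lambda>z. disc_tf H D z $$ (i, j)) holomorphic_on ball 0 1"
proof -
  have "cayley holomorphic_on ball 0 1"
    unfolding cayley_def[abs_def] by (intro holomorphic_intros) auto
  moreover have "eval_ratfun (H $$ (i, j)) holomorphic_on {s. 0 \<le> Re s}"
    using H ij by (intro eval_ratfun_holomorphic regular_mat_atD reg) auto
  ultimately have "(eval_ratfun (H $$ (i, j)) \<circ> cayley) holomorphic_on ball 0 1"
    by (rule holomorphic_on_compose_gen) (auto intro: Re_cayley_nonneg)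
  then show ?thesis
    by (rule holomorphic_transform) (use H ij in \<open>auto simp: disc_tf_def eval_tf_def\<close>)
qed

lemma eval_tf_cnj: "eval_tf H (cnj s) = map_mat cnj (eval_tf H s)"
  by (intro eq_matI) (auto simp: eval_tf_def eval_ratfun_cnj)

lemma transfer_function_carrier: "lti_system n m A B C D \<Longrightarrow> transfer_function A B C D \<in> carrier_mat m m"
  by (auto simp: lti_system_def transfer_function_def)

lemma proper_tf_limit:
  assumes "proper_tf H" "H \<in> carrier_mat m m"
  obtains D :: "complex mat" where "D \<in> carrier_mat m m"
    "\<And>i j. i < m \<Longrightarrow> j < m \<Longrightarrow> ((\<lambda>s. eval_tf H s $$ (i, j)) \<longlongrightarrow> D $$ (i, j)) at_infinity"
proof -
  obtain D :: "real mat" where D: "D \<in> carrier_mat m m"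
    "mat_tendsto (eval_tf H) (map_mat complex_of_real D) at_infinity"
    using assms by (auto simp: proper_tf_def)
  show thesis
  proof
    show "map_mat complex_of_real D \<in> carrier_mat m m" using D by simp
    show "((\<lambda>s. eval_tf H s $$ (i, j)) \<longlongrightarrow> map_mat complex_of_real D $$ (i, j)) at_infinity" if "i < m" "j < m" for i j
      using D that unfolding mat_tendsto_def by auto
  qed
qed

lemma imaginary_axis_at_infinity: "filterlim (\<lambda>w. \<i> * complex_of_real w) at_infinity at_top"
  unfolding filterlim_at_infinity_conv_norm_at_top
  using filterlim_abs_real by (simp add: norm_mult)

text \<open>Pulled back to the disc, the homotopy has gain \<open>1 - k\<close> and shift
  \<open>\<epsilon> * k\<close>. On the circle it is nonzero by the assumptions on the imaginary
  axis and at infinity, so \<open>disc_homotopy_nonvanishing\<close> carries the absence of zeros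
  from \<open>k = 1\<close> to the given loop at \<open>k = 0\<close>.\<close>

lemma det_loop_nonzero_closed_rhp:
  assumes H: "H1 \<in> carrier_mat m m" "H2 \<in> carrier_mat m m"
    and reg: "\<And>s. 0 \<le> Re s \<Longrightarrow> regular_mat_at H1 s" "\<And>s. 0 \<le> Re s \<Longrightarrow> regular_mat_at H2 s"
    and D: "D1 \<in> carrier_mat m m" "D2 \<in> carrier_mat m m"
    and lim: "\<And>i j. i < m \<Longrightarrow> j < m \<Longrightarrow> ((\<lambda>s. eval_tf H1 s $$ (i, j)) \<longlongrightarrow> D1 $$ (i, j)) at_infinity"
      "\<And>i j. i < m \<Longrightarrow> j < m \<Longrightarrow> ((\<lambda>s. eval_tf H2 s $$ (i, j)) \<longlongrightarrow> D2 $$ (i, j)) at_infinity"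
    and \<epsilon>: "\<And>w \<tau> t. 0 \<le> w \<Longrightarrow> 0 \<le> \<tau> \<Longrightarrow> \<tau> \<le> 1 \<Longrightarrow> 0 \<le> t \<Longrightarrow> t \<le> \<epsilon> \<Longrightarrow>
        det (loop_mat m \<tau> t (eval_tf H2 (\<i> * complex_of_real w)) (eval_tf H1 (\<i> * complex_of_real w))) \<noteq> 0"
      "\<And>k. 0 \<le> k \<Longrightarrow> k \<le> 1 \<Longrightarrow> det (loop_mat m (1 - k) (\<epsilon> * k) D2 D1) \<noteq> 0" "0 \<le> \<epsilon>"
    and s: "0 \<le> Re s"
  shows "det (1\<^sub>m m + eval_tf H2 s * eval_tf H1 s) \<noteq> 0"
proof -
  define F where "F k z = det (loop_mat m (1 - k) (\<epsilon> * k) (disc_tf H2 D2 z) (disc_tf H1 D1 z))" for k z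
  note c = disc_tf_carrier[OF H(2) D(2)] disc_tf_carrier[OF H(1) D(1)]
  obtain z where z: "cmod z \<le> 1" "z \<noteq> 1" "cayley z = s" using cayley_surj[OF s] .
  have "F 0 z \<noteq> 0"
  proof (rule disc_homotopy_nonvanishing[where F = F])
    have "continuous_on ({0..1} \<times> cball 0 1) (\<lambda>p. F (fst p) (snd p))"
      unfolding F_def
    proof (rule continuous_on_det_loop_mat)
      fix i j assume ij: "i < m" "j < m"
      show "continuous_on ({0..1 :: real} \<times> cball 0 1) (\<lambda>p. disc_tf H2 D2 (snd p) $$ (i, j))"
        by (rule continuous_on_compose2[OF disc_tf_continuous_on[OF H(2) reg(2) lim(2)[OF ij] ij]])
          (auto intro: continuous_intros)
      show "continuous_on ({0..1 :: real} \<times> cball 0 1) (\<lambda>p. disc_tf H1 D1 (snd p) $$ (i, j))"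
        by (rule continuous_on_compose2[OF disc_tf_continuous_on[OF H(1) reg(1) lim(1)[OF ij] ij]])
          (auto intro: continuous_intros)
    qed (intro c continuous_intros)+
    then show "continuous_on ({0..1} \<times> cball 0 1) (\<lambda>(k, z). F k z)" by (simp add: case_prod_unfold)
    show "F k holomorphic_on ball 0 1" for k
      unfolding F_def
      by (intro holomorphic_on_det_loop_mat c disc_tf_holomorphic_on[OF H(1) reg(1)] disc_tf_holomorphic_on[OF H(2) reg(2)])
    \<comment> \<open>The gain is zero here and the loop matrix is the identity.\<close>
    show "F 1 z \<noteq> 0" for z
      by (simp add: F_def loop_mat_zero[OF c])
    show "cmod z \<le> 1" by (rule z)
    fix k :: real and z :: complex assume k: "k \<in> {0..1}" and z1: "cmod z = 1"
    have ek: "0 \<le> \<epsilon> * k" "\<epsilon> * k \<le> \<epsilon>" using k \<epsilon>(3) by (auto simp: mult_left_le)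
    show "F k z \<noteq> 0"
    proof (cases "z = 1")
      case True
      then show ?thesis using \<epsilon>(2) k by (simp add: F_def disc_tf_def)
    next
      case False
      define w where "w = Im (cayley z)"
      have w: "cayley z = \<i> * complex_of_real w" unfolding w_def by (rule cayley_imaginary[OF z1])
      have e: "F k z = det (loop_mat m (1 - k) (\<epsilon> * k) (eval_tf H2 (\<i> * complex_of_real w)) (eval_tf H1 (\<i> * complex_of_real w)))"
        using False by (simp add: F_def disc_tf_def w)
      show ?thesis
      proof (cases "0 \<le> w")
        case True
        then show ?thesis unfolding e using k ek by (intro \<epsilon>(1)) auto
      next
        case False
        have "cnj (F k z) \<noteq> 0"
          unfolding e det_loop_mat_cnj[OF eval_tf_carrier[OF H(2)] eval_tf_carrier[OF H(1)], symmetric]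
            eval_tf_cnj[symmetric]
          using \<epsilon>(1)[of "- w" "1 - k" "\<epsilon> * k"] False k ek by simp
        then show ?thesis by simp
      qed
    qed
  qed
  then show ?thesis
    using z by (simp add: F_def disc_tf_def loop_mat_unshifted eval_tf_carrier[OF H(1)] eval_tf_carrier[OF H(2)])
qed

theorem theorem2:
  fixes m n1 n2 :: nat
    and A1 B1 C1 D1 A2 B2 C2 D2 :: "real mat"
    and H1 H2 :: "ratfun mat"
    and Hinf :: "complex mat"
  assumes m: "0 < m"
    and sys1: "lti_system n1 m A1 B1 C1 D1"
    and sys2: "lti_system n2 m A2 B2 C2 D2"
    and H1: "H1 = transfer_function A1 B1 C1 D1"
    and H2: "H2 = transfer_function A2 B2 C2 D2"
    and proper1: "proper_tf H1"
    and proper2: "proper_tf H2"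
    and stable1: "stable_tf H1"
    and stable2: "stable_tf H2"
    and zeros1: "\<forall>s. zero_of H1 s \<longrightarrow> Re s \<noteq> 0"
    and zeros2: "\<forall>s. zero_of H2 s \<longrightarrow> Re s \<noteq> 0"
    and index12: "\<forall>\<omega>\<ge>0. ifp_index H1 \<omega> + ofp_index H2 \<omega> > 0"
    and index21: "\<forall>\<omega>\<ge>0. ifp_index H2 \<omega> + ofp_index H1 \<omega> > 0"
    and Hinf: "mat_tendsto
      (\<lambda>\<omega>. eval_tf H1 (\<i> * complex_of_real \<omega>) * eval_tf H2 (\<i> * complex_of_real \<omega>)) Hinf at_top"
    and eig: "\<not> eigenvalue Hinf (- 1)"
  shows "feedback_stable H1 H2"
proof -
  have H: "H1 \<in> carrier_mat m m" "H2 \<in> carrier_mat m m"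
    unfolding H1 H2 using sys1 sys2 by (auto intro: transfer_function_carrier)
  note reg = stable_tf_regular[OF stable1] stable_tf_regular[OF stable2]
  obtain E1 where E1: "E1 \<in> carrier_mat m m"
    "\<And>i j. i < m \<Longrightarrow> j < m \<Longrightarrow> ((\<lambda>s. eval_tf H1 s $$ (i, j)) \<longlongrightarrow> E1 $$ (i, j)) at_infinity"
    using proper_tf_limit[OF proper1 H(1)] by metis
  obtain E2 where E2: "E2 \<in> carrier_mat m m"
    "\<And>i j. i < m \<Longrightarrow> j < m \<Longrightarrow> ((\<lambda>s. eval_tf H2 s $$ (i, j)) \<longlongrightarrow> E2 $$ (i, j)) at_infinity"
    using proper_tf_limit[OF proper2 H(2)] by metis
  define G1 where "G1 w = eval_tf H1 (\<i> * complex_of_real w)" for w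
  define G2 where "G2 w = eval_tf H2 (\<i> * complex_of_real w)" for w
  have G: "G1 w \<in> carrier_mat m m" "G2 w \<in> carrier_mat m m" for w
    using H by (auto simp: G1_def G2_def eval_tf_carrier)
  have lim: "mat_lim m G1 E1 at_top" "mat_lim m G2 E2 at_top"
    unfolding mat_lim_def using E1(1) E2(1) G
    by (auto simp: G1_def G2_def intro!: filterlim_compose[OF E1(2) imaginary_axis_at_infinity]
        filterlim_compose[OF E2(2) imaginary_axis_at_infinity])
  have cont: "continuous_on {0..} (\<lambda>w. eval_tf A (\<i> * complex_of_real w) $$ (i, j))"
    if "A \<in> carrier_mat m m" "\<And>s. 0 \<le> Re s \<Longrightarrow> regular_mat_at A s" "i < m" "j < m" for A i j
  proof -
    have "continuous_on {s. 0 \<le> Re s} (eval_ratfun (A $$ (i, j)))"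
      using that by (intro holomorphic_on_imp_continuous_on eval_ratfun_holomorphic regular_mat_atD) auto
    then have "continuous_on {0..} (\<lambda>w. eval_ratfun (A $$ (i, j)) (\<i> * complex_of_real w))"
      by (rule continuous_on_compose2) (auto intro!: continuous_intros)
    then show ?thesis using that by (simp add: eval_tf_def)
  qed
  have contG: "continuous_on {0..} (\<lambda>w. G1 w $$ (i, j))" "continuous_on {0..} (\<lambda>w. G2 w $$ (i, j))"
    if "i < m" "j < m" for i j
    unfolding G1_def G2_def using cont[OF H(1) reg(1)] cont[OF H(2) reg(2)] that by simp_all
  \<comment> \<open>At full gain, a kernel vector at infinity would be an eigenvector of
    \<open>Hinf = E1 * E2\<close> for the eigenvalue \<open>-1\<close>.\<close>
  have "det (loop_mat m 1 0 E1 E2) \<noteq> 0"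
  proof
    assume "det (loop_mat m 1 0 E1 E2) = 0"
    then obtain x y where x: "x \<in> carrier_vec m" "x \<noteq> 0\<^sub>v m" and y: "y = E2 *\<^sub>v x"
      and xy: "x = complex_of_real (- 1) \<cdot>\<^sub>v (E1 *\<^sub>v y)"
      using det_loop_mat_eq_0E[OF E1(1) E2(1)] shift_mat_zero[OF E1(1)] shift_mat_zero[OF E2(1)] by metis
    have "Hinf = E1 * E2"
    proof -
      \<comment> \<open>\<open>mat_tendsto\<close> fixes the dimensions only eventually; one
        frequency where it does determines those of \<open>Hinf\<close>.\<close>
      obtain w where "G1 w * G2 w \<in> carrier_mat (dim_row Hinf) (dim_col Hinf)"
        using Hinf eventually_happens'[OF trivial_limit_at_top_linorder]
        unfolding mat_tendsto_def G1_def G2_def by blast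
      then have d: "dim_row Hinf = m" "dim_col Hinf = m" using G[of w] by auto
      show ?thesis
      proof (rule eq_matI)
        fix i j assume "i < dim_row (E1 * E2)" "j < dim_col (E1 * E2)"
        then have ij: "i < m" "j < m" using E1(1) E2(1) by auto
        have e: "(A * B) $$ (i, j) = (\<Sum>k<m. A $$ (i, k) * B $$ (k, j))"
          if "A \<in> carrier_mat m m" "B \<in> carrier_mat m m" for A B :: "complex mat"
          using that ij by (auto simp: scalar_prod_def lessThan_atLeast0 intro!: sum.cong)
        have "((\<lambda>w. \<Sum>k<m. G1 w $$ (i, k) * G2 w $$ (k, j)) \<longlongrightarrow> (\<Sum>k<m. E1 $$ (i, k) * E2 $$ (k, j))) at_top"
          using lim ij by (intro tendsto_intros) (auto simp: mat_lim_def)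
        then have "((\<lambda>w. (G1 w * G2 w) $$ (i, j)) \<longlongrightarrow> (E1 * E2) $$ (i, j)) at_top"
          by (simp only: e G E1(1) E2(1))
        moreover have "((\<lambda>w. (G1 w * G2 w) $$ (i, j)) \<longlongrightarrow> Hinf $$ (i, j)) at_top"
          using Hinf[unfolded mat_tendsto_def d, THEN conjunct2, rule_format, OF ij]
          by (simp only: G1_def G2_def)
        ultimately show "Hinf $$ (i, j) = (E1 * E2) $$ (i, j)"
          using tendsto_unique[OF trivial_limit_at_top_linorder] by blast
      qed (use d E1(1) E2(1) in auto)
    qed
    moreover have "(E1 * E2) *\<^sub>v x = (- 1) \<cdot>\<^sub>v x"
    proof -
      have "(- 1) \<cdot>\<^sub>v x = E1 *\<^sub>v y" by (subst xy) (simp add: smult_smult_assoc)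
      then show ?thesis unfolding y using assoc_mult_mat_vec[OF E1(1) E2(1) x(1)] by simp
    qed
    ultimately have "eigenvalue Hinf (- 1)"
      unfolding eigenvalue_def eigenvector_def using x E1(1) E2(1) by auto
    then show False using eig by simp
  qed
  \<comment> \<open>\<open>Hinf\<close> is built from \<open>H1 H2\<close>, whereas the closed loop
    involves \<open>H2 H1\<close>.\<close>
  then have nz: "det (loop_mat m 1 0 E2 E1) \<noteq> 0" using det_loop_mat_swap[OF E2(1) E1(1)] by blast
  have Re0: "Re (\<i> * complex_of_real w) = 0" for w by simp
  have nzero: "\<not> zero_of H1 (\<i> * complex_of_real w)" "\<not> zero_of H2 (\<i> * complex_of_real w)" for w
    using zeros1 zeros2 Re0 by blast+
  \<comment> \<open>Without zeros on the imaginary axis, the inverse inside \<open>ofp_index\<close>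
    is a genuine one.\<close>
  have dG1: "det (G1 w) \<noteq> 0" for w
    unfolding G1_def by (rule det_eval_tf_nonzero[OF H(1) m reg(1) nzero(1)]) simp
  have dG2: "det (G2 w) \<noteq> 0" for w
    unfolding G2_def by (rule det_eval_tf_nonzero[OF H(2) m reg(2) nzero(2)]) simp
  have indices: "ofp (G1 w) (ofp_index H1 w)" "ofp (G2 w) (ofp_index H2 w)"
    "ifp (G1 w) (ifp_index H1 w)" "ifp (G2 w) (ifp_index H2 w)" for w
    using ofp_index_ofp[OF H(1) m] ofp_index_ofp[OF H(2) m] ifp_index_ifp[OF H(1) m] ifp_index_ifp[OF H(2) m] dG1 dG2
    unfolding G1_def G2_def by blast+
  obtain \<epsilon> where \<epsilon>: "0 \<le> \<epsilon>"
    "\<And>w \<tau> t. 0 \<le> w \<Longrightarrow> 0 \<le> \<tau> \<Longrightarrow> \<tau> \<le> 1 \<Longrightarrow> 0 \<le> t \<Longrightarrow> t \<le> \<epsilon> \<Longrightarrow> det (loop_mat m \<tau> t (G2 w) (G1 w)) \<noteq> 0"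
    "\<And>k. 0 \<le> k \<Longrightarrow> k \<le> 1 \<Longrightarrow> det (loop_mat m (1 - k) (\<epsilon> * k) E2 E1) \<noteq> 0"
    by (rule det_loop_mat_shift_interval[OF lim contG indices(3,1,4,2) _ _ nz])
      (use index12 index21 in \<open>blast+\<close>)
  have "det (1\<^sub>m m + eval_tf H2 s * eval_tf H1 s) \<noteq> 0" if "0 \<le> Re s" for s
    using that
    by (intro det_loop_nonzero_closed_rhp[OF H reg E1(1) E2(1) E1(2) E2(2) \<epsilon>(2)[unfolded G1_def G2_def] \<epsilon>(3,1)])
  then show ?thesis by (intro feedback_stableI[OF H] reg)
qed

end
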